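(* Let $1\le m<d$, $n=d-m$, let $A\in\mathbb R^{d\times m}$ have full column rank, $B\in\mathscr B_A$, and let $\Sigma_\star\in\mathscr P_n$ satisfy $\Phi_A(B,\Sigma_\star)=s_A(B)$. Let $\Sigma_0\in\mathscr P_n$, $D_0=d_{\mathrm{AI}}(R_0,\mathcal Q_{\Sigma_0})$, let $\widehat D_0\ge D_0$, fix $0\le\delta<1$, and put $$\widehat L_0=\psi(\widehat D_0/\sqrt2),\quad c_\delta=\left(\frac{1-\delta}{1+\delta}\right)^2,\quad \widehat q_\delta=1-\frac{c_\delta}{\widehat L_0},\quad \eta=\frac{1-\delta}{\widehat L_0(1+\delta)^2}.$$ Suppose that at every step $k\ge0$ one is given a symmetric trace-free matrix $\widetilde W_k=W_B(\Sigma_k)+E_k$ and a number $b_k\ge\|E_k\|_F$ with $$b_k\le\frac{\delta}{1+\delta}\|\widetilde W_k\|_F,$$ and that $$\Sigma_{k+1}=\Sigma_k^{1/2}\exp(\eta\widetilde W_k)\Sigma_k^{1/2}.$$ Then the objective radius $d_{\mathrm{AI}}(R_0,\mathcal Q_{\Sigma_k})$ is nonincreasing in $k$, and for all $k\ge0$ $$f_B(\Sigma_k)-f_B(\Sigma_\star)\le\frac{\widehat D_0^2}{2}\widehat q_\delta^{\,k},\qquad d_{\mathrm{AI}}(\Phi_A(B,\Sigma_k),s_A(B))\le\widehat D_0\,\widehat q_\delta^{\,k/2},$$ $$\|\widetilde W_k\|_F\le\frac{(1+\delta)^2}{1-\delta}\sqrt{\widehat L_0}\,\widehat D_0\,\widehat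 q_\delta^{\,k/2}.$$ The observed residual also certifies $$d_{\mathrm{AI}}(\Phi_A(B,\Sigma_k),s_A(B))\le\frac{\|\widetilde W_k\|_F}{1-\delta},\qquad f_B(\Sigma_k)-f_B(\Sigma_\star)\le\frac{\|\widetilde W_k\|_F^2}{2(1-\delta)^2}.$$
   Context: $\psi(s)=s\coth s$ for $s>0$, $\psi(0)=1$; $0^0=1$. $\mathbb S_{++}^d$ denotes real symmetric positive definite matrices with affine-invariant distance $d_{\mathrm{AI}}(P,P')=\|\log(P^{-1/2}P'P^{-1/2})\|_F$; $\mathscr P_d=\{P\in\mathbb S_{++}^d:\det P=1\}$. $\mathscr B_A=\{B\in\mathbb R^{d\times m}:A^\top B\in\mathbb S_{++}^m\}$. Fix $A=UC$ with $U^\top U=I_m$, $C$ invertible, and $Q=[U,V]\in O(d)$. For $B\in\mathscr B_A$ let $M=C^{-\top}A^\top BC^{-1}$, $N=V^\top BC^{-1}$, $T=NM^{-1}$, $L=\begin{pmatrix}I_m&0\\ T&I_n\end{pmatrix}$, $\rho=(\det M)^{-1/n}$, $\mathcal Q_\Sigma=\operatorname{diag}(M,\rho\Sigma)$, $\Phi_A(B,\Sigma)=QL\mathcal Q_\Sigma L^\top Q^\top$ for $\Sigma\in\mathscr P_n$. The canonical controller $s_A(B)$ is the unique minimizer of $d_{\mathrm{AI}}(I,P)$ over $\{P\in\mathscr P_d:PA=B\}$. Put $R_0=L^{-1}L^{-\top}$, $f_B(\Sigma)=\tfrac12d_{\mathrm{AI}}(R_0,\mathcal Q_\Sigma)^2$,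 $\mathcal R(\Sigma)=\log(\mathcal Q_\Sigma^{-1/2}R_0\mathcal Q_\Sigma^{-1/2})$ with lower-right $n\times n$ block $\mathcal R_{22}(\Sigma)$, and $W_B(\Sigma)=\mathcal R_{22}(\Sigma)-\frac{\operatorname{tr}\mathcal R_{22}(\Sigma)}nI_n$. *)

theory Defs
  imports "HOL-Analysis.Analysis"
begin

text \<open>
  Matrices are taken over finite index types. The ambient space of dimension \<open>d = m + n\<close> is
  indexed by the sum type \<open>'m + 'n\<close>, so that \<open>1 \<le> m < d\<close> and \<open>n = d - m\<close> hold by construction.
  The Frobenius norm is \<^const>\<open>norm\<close> on \<open>real^'a^'b\<close>. The product on that type is componentwise,
  so neither the library powers nor the library exponential can be used on matrices.
\<close>

definition psi :: "real \<Rightarrow> real" where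
  "psi s = (if s = 0 then 1 else s * cosh s / sinh s)"

definition spd :: "(real^'a^'a) set" where
  "spd = {P. transpose P = P \<and> (\<forall>x. x \<noteq> 0 \<longrightarrow> x \<bullet> (P *v x) > 0)}"

definition spd1 :: "(real^'a^'a) set" where
  "spd1 = {P \<in> spd. det P = 1}"

definition mexp :: "real^'a^'a \<Rightarrow> real^'a^'a" where
  "mexp X = (\<Sum>k. (1 / fact k) *\<^sub>R (((**) X ^^ k) (mat 1)))"

text \<open>
  The next two functions are meant for positive definite arguments only, where the described
  matrix exists and is unique.
\<close>

definition mlog :: "real^'a^'a \<Rightarrow> real^'a^'a" where
  "mlog P = (THE X. transpose X = X \<and> mexp X = P)"

definition msqrt :: "real^'a^'a \<Rightarrow> real^'a^'a" where
  "msqrt P = (THE S. S \<in> spd \<and> S ** S = P)"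

definition d_AI :: "real^'a^'a \<Rightarrow> real^'a^'a \<Rightarrow> real" where
  "d_AI P P' = norm (mlog (matrix_inv (msqrt P) ** P' ** matrix_inv (msqrt P)))"

definition feasible_targets :: "real^'b^'a \<Rightarrow> (real^'b^'a) set" where
  "feasible_targets A = {B. transpose A ** B \<in> spd}"

definition controller :: "real^'b^'a \<Rightarrow> real^'b^'a \<Rightarrow> real^'a^'a" where
  "controller A B = (THE P. is_arg_min (d_AI (mat 1)) (\<lambda>P. P \<in> spd1 \<and> P ** A = B) P)"

definition hcat :: "real^'m^'d \<Rightarrow> real^'n^'d \<Rightarrow> real^('m + 'n)^'d" where
  "hcat U V = (\<chi> i j. case j of Inl a \<Rightarrow> U $ i $ a | Inr b \<Rightarrow> V $ i $ b)"

definition four_block ::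
    "real^'m^'m \<Rightarrow> real^'n^'m \<Rightarrow> real^'m^'n \<Rightarrow> real^'n^'n \<Rightarrow> real^('m + 'n)^('m + 'n)" where
  "four_block X11 X12 X21 X22 = (\<chi> i j.
     case i of
       Inl a \<Rightarrow> (case j of Inl b \<Rightarrow> X11 $ a $ b | Inr b \<Rightarrow> X12 $ a $ b)
     | Inr a \<Rightarrow> (case j of Inl b \<Rightarrow> X21 $ a $ b | Inr b \<Rightarrow> X22 $ a $ b))"

definition lower_right :: "real^('m::finite + 'n::finite)^('m + 'n) \<Rightarrow> real^'n^'n" where
  "lower_right X = (\<chi> i j. X $ Inr i $ Inr j)"

definition M_of :: "real^'m^'m \<Rightarrow> real^'m^'d \<Rightarrow> real^'m^'d \<Rightarrow> real^'m^'m" where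
  "M_of C A B = matrix_inv (transpose C) ** transpose A ** B ** matrix_inv C"

definition N_of :: "real^'n^'d \<Rightarrow> real^'m^'m \<Rightarrow> real^'m^'d \<Rightarrow> real^'m^'n" where
  "N_of V C B = transpose V ** B ** matrix_inv C"

definition T_of :: "real^'n^'d \<Rightarrow> real^'m^'m \<Rightarrow> real^'m^'d \<Rightarrow> real^'m^'d \<Rightarrow> real^'m^'n" where
  "T_of V C A B = N_of V C B ** matrix_inv (M_of C A B)"

definition L_of ::
    "real^'n^'d \<Rightarrow> real^'m^'m \<Rightarrow> real^'m^'d \<Rightarrow> real^'m^'d \<Rightarrow> real^('m + 'n)^('m + 'n)" where
  "L_of V C A B = four_block (mat 1) 0 (T_of V C A B) (mat 1)"

text \<open>The matrix \<open>diag(M, \<rho> S)\<close> with \<open>\<rho> = (det M) powr (-1/n)\<close>.\<close>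

definition Q_of ::
    "real^'m^'m \<Rightarrow> real^'m^'d \<Rightarrow> real^'m^'d \<Rightarrow> real^'n^'n \<Rightarrow> real^('m + 'n)^('m + 'n)" where
  "Q_of C A B S =
     four_block (M_of C A B) 0 0 ((det (M_of C A B) powr (- 1 / real CARD('n))) *\<^sub>R S)"

definition Phi ::
    "real^'m^('m + 'n) \<Rightarrow> real^'n^('m + 'n) \<Rightarrow> real^'m^'m \<Rightarrow> real^'m^('m + 'n) \<Rightarrow>
     real^'m^('m + 'n) \<Rightarrow> real^'n^'n \<Rightarrow> real^('m + 'n)^('m + 'n)" where
  "Phi U V C A B S =
     hcat U V ** L_of V C A B ** Q_of C A B S ** transpose (L_of V C A B) ** transpose (hcat U V)"

definition R0_of ::
    "real^'n^'d \<Rightarrow> real^'m^'m \<Rightarrow> real^'m^'d \<Rightarrow> real^'m^'d \<Rightarrow> real^('m + 'n)^('m + 'n)" where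
  "R0_of V C A B = matrix_inv (L_of V C A B) ** matrix_inv (transpose (L_of V C A B))"

definition f_obj ::
    "real^'n^'d \<Rightarrow> real^'m^'m \<Rightarrow> real^'m^'d \<Rightarrow> real^'m^'d \<Rightarrow> real^'n^'n \<Rightarrow> real" where
  "f_obj V C A B S = (1 / 2) * (d_AI (R0_of V C A B) (Q_of C A B S))\<^sup>2"

definition R_log ::
    "real^'n^'d \<Rightarrow> real^'m^'m \<Rightarrow> real^'m^'d \<Rightarrow> real^'m^'d \<Rightarrow> real^'n^'n \<Rightarrow>
     real^('m + 'n)^('m + 'n)" where
  "R_log V C A B S =
     mlog (matrix_inv (msqrt (Q_of C A B S)) ** R0_of V C A B ** matrix_inv (msqrt (Q_of C A B S)))"

definition W_of ::
    "real^'n^'d \<Rightarrow> real^'m^'m \<Rightarrow> real^'m^'d \<Rightarrow> real^'m^'d \<Rightarrow> real^'n^'n \<Rightarrow> real^'n^'n" where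
  "W_of V C A B S =
     lower_right (R_log V C A B S)
     - (trace (lower_right (R_log V C A B S)) / real CARD('n)) *\<^sub>R mat 1"

end

theory Submission
  imports Defs "HOL-Real_Asymp.Real_Asymp"
begin

text \<open>
The objective is half a squared distance on the positive definite matrices, so everything rests
on two bounds for its second derivative along a geodesic $P_t = P^{1/2} e^{tH} P^{1/2}$:
it is at least $\|H\|^2$, because the curvature is nonpositive, and at most
$\psi(D/\sqrt 2)\,\|H\|^2$ as long as the geodesic stays within distance $D$ of the base point,
because the curvature is at least $-1/2$.

Neither bound is obtained by differentiating the matrix logarithm. If $u_i$ and $v_j$ are
eigenbases of two symmetric matrices with eigenvalues $l_i$ and $m_j$, then a function of these
matrices has the exact mixed entries $u_i \cdot (f(X) - f(Y)) v_j = (f(l_i) - f(m_j))\,u_i \cdot v_j$.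
So an inequality between scalar functions becomes an inequality between Frobenius norms or
traces for matrices that do not commute. For the lower bound, this gives
$\|\log P - \log P'\|^2 \le 2\,\mathrm{tr}\,(\cosh R) - 2d$, where $R$ is the logarithm of $P'$
relative to $P$; cutting a geodesic into $N$ pieces and letting $N$ grow gives
\<open>exponential_metric_increasing\<close>, which is the comparison of a geodesic triangle with a Euclidean
one. For the upper bound, \<open>log_displacement_identity\<close> evaluates exactly how a logarithm moves
under a congruence by $e^{X}$, as a sum weighted by $\psi$ at half the differences of
eigenvalues. Two different eigenvalues of a matrix of norm $D$ differ by at most $\sqrt 2\,D$,
which is where $\psi(D/\sqrt 2)$ comes from. Summing the identity along a fine partition bounds
the increase of the slope of the objective (\<open>slope_upper\<close>).

The map $\Sigma \mapsto \mathcal Q_\Sigma$ carries the geodesic in the trace-free direction $X$ to the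
geodesic in the direction $\mathrm{diag}(0, X)$, so $-W_B$ is the gradient of $f_B$ and both bounds
pass to $f_B$. The point $\Sigma_\star$ minimizes $f_B$: congruence by $QL$ identifies the
distance from $I$ to $\Phi_A(B,\Sigma)$ with the distance from $R_0$ to $\mathcal Q_\Sigma$, and the
canonical controller really is a minimizer (\<open>controller_minimizes\<close>). Strong convexity then
bounds the gap by $\|W_B\|^2/2$ and bounds the squared distance to the minimizer by twice the gap.
The relative error condition keeps $\widetilde W_k$ a descent direction, and the step size
balances the two terms of the upper quadratic bound. That the whole step stays in the ball follows
from convexity: a point of the step at which the objective returned to its initial value would
contradict the same quadratic bound (\<open>energy_descent\<close>).
\<close>

section \<open>Orthonormal eigenbases and the spectral theorem\<close>

definition orthonormal_basis :: "('a::finite \<Rightarrow> real^'a) \<Rightarrow> bool" where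
  "orthonormal_basis u \<longleftrightarrow> (\<forall>i j. u i \<bullet> u j = (if i = j then 1 else 0))"

text \<open>
Eigenvalues carry the index of their eigenvector, so they are neither ordered nor required to be
distinct, and one basis can serve several commuting matrices.
\<close>

definition eigenbasis :: "('a::finite \<Rightarrow> real^'a) \<Rightarrow> ('a \<Rightarrow> real) \<Rightarrow> real^'a^'a \<Rightarrow> bool" where
  "eigenbasis u l X \<longleftrightarrow> orthonormal_basis u \<and> (\<forall>i. X *v u i = l i *\<^sub>R u i)"

definition spectral :: "('a::finite \<Rightarrow> real^'a) \<Rightarrow> ('a \<Rightarrow> real) \<Rightarrow> real^'a^'a" where
  "spectral u l = (\<Sum>i\<in>UNIV. l i *\<^sub>R (\<chi> a b. u i $ a * u i $ b))"

lemma eigenbasisD: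
  assumes "eigenbasis u l X"
  shows "orthonormal_basis u" "X *v u i = l i *\<^sub>R u i"
  using assms by (auto simp: eigenbasis_def)

lemma orthonormal_basisD:
  "orthonormal_basis u \<Longrightarrow> u i \<bullet> u j = (if i = j then 1 else 0)"
  by (simp add: orthonormal_basis_def)

lemma inner_orthonormal_basis:
  assumes "orthonormal_basis u"
  shows "x \<bullet> y = (\<Sum>i\<in>UNIV. (u i \<bullet> x) * (u i \<bullet> y))"
proof -
  define U where "U = (\<chi> i. u i)"
  have UU: "U ** transpose U = mat 1"
    using assms
    by (simp add: U_def vec_eq_iff matrix_matrix_mult_def transpose_def mat_def
        inner_vec_def orthonormal_basis_def)
  then have UU': "transpose U ** U = mat 1"
    by (simp add: matrix_left_right_inverse)
  have "x \<bullet> y = (U *v x) \<bullet> (U *v y)"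
    by (metis UU' dot_lmul_matrix matrix_vector_mul_assoc matrix_vector_mul_lid transpose_matrix_vector)
  also have "\<dots> = (\<Sum>i\<in>UNIV. (u i \<bullet> x) * (u i \<bullet> y))"
    by (subst inner_vec_def) (simp add: matrix_vector_mul_component U_def)
  finally show ?thesis .
qed

lemma vec_eqI_orthonormal_basis:
  assumes "orthonormal_basis u" "\<And>i. u i \<bullet> x = u i \<bullet> y"
  shows "x = y"
proof -
  have "(x - y) \<bullet> (x - y) = 0"
    by (subst inner_orthonormal_basis[OF assms(1)]) (simp add: inner_diff_right assms(2))
  then show ?thesis by simp
qed

lemma matrix_inner_orthonormal_basis:
  fixes X Y :: "real^'a::finite^'b::finite"
  assumes "orthonormal_basis v"
  shows "X \<bullet> Y = (\<Sum>j\<in>UNIV. (X *v v j) \<bullet> (Y *v v j))"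
proof -
  have "X \<bullet> Y = (\<Sum>i\<in>UNIV. \<Sum>j\<in>UNIV. (v j \<bullet> X $ i) * (v j \<bullet> Y $ i))"
    by (subst inner_vec_def) (simp add: inner_orthonormal_basis[OF assms, symmetric])
  also have "\<dots> = (\<Sum>j\<in>UNIV. \<Sum>i\<in>UNIV. (v j \<bullet> X $ i) * (v j \<bullet> Y $ i))"
    by (rule sum.swap)
  also have "\<dots> = (\<Sum>j\<in>UNIV. (X *v v j) \<bullet> (Y *v v j))"
    by (intro sum.cong refl, subst inner_vec_def)
       (simp add: matrix_vector_mul_component inner_commute)
  finally show ?thesis .
qed

text \<open>
Rows and columns may be expanded in different bases. Using an eigenbasis of one matrix on the
left and of another on the right is what later makes non-commuting pairs tractable.
\<close>

lemma matrix_inner_two_bases: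
  fixes X Y :: "real^'a::finite^'b::finite"
  assumes "orthonormal_basis u" "orthonormal_basis v"
  shows "X \<bullet> Y = (\<Sum>j\<in>UNIV. \<Sum>i\<in>UNIV. (u i \<bullet> (X *v v j)) * (u i \<bullet> (Y *v v j)))"
  by (simp add: matrix_inner_orthonormal_basis[OF assms(2)]
       inner_orthonormal_basis[OF assms(1), symmetric])

lemma norm2_matrix_two_bases:
  fixes X :: "real^'a::finite^'b::finite"
  assumes "orthonormal_basis u" "orthonormal_basis v"
  shows "(norm X)\<^sup>2 = (\<Sum>j\<in>UNIV. \<Sum>i\<in>UNIV. (u i \<bullet> (X *v v j))\<^sup>2)"
  unfolding power2_norm_eq_inner matrix_inner_two_bases[OF assms] by (simp add: power2_eq_square)

lemma matrix_eqI_orthonormal_basis: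
  fixes X Y :: "real^'a::finite^'b::finite"
  assumes "orthonormal_basis v" "\<And>j. X *v v j = Y *v v j"
  shows "X = Y"
proof -
  have "(X - Y) \<bullet> (X - Y) = 0"
    by (subst matrix_inner_orthonormal_basis[OF assms(1)])
       (simp add: matrix_vector_mult_diff_rdistrib assms(2))
  then show ?thesis by simp
qed

lemma transpose_inner:
  fixes X :: "real^'a::finite^'b::finite"
  shows "x \<bullet> (X *v y) = (transpose X *v x) \<bullet> y"
  by (metis dot_lmul_matrix transpose_matrix_vector)

lemma trace_orthonormal_basis:
  assumes "orthonormal_basis u"
  shows "trace X = (\<Sum>i\<in>UNIV. u i \<bullet> (X *v u i))"
proof -
  have "trace X = mat 1 \<bullet> X"
    by (simp add: trace_def inner_vec_def mat_def if_distrib[where f="\<lambda>x. x * _"] cong: if_cong)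
  then show ?thesis by (simp add: matrix_inner_orthonormal_basis[OF assms])
qed

lemma matrix_inner_trace:
  fixes X Y :: "real^'a::finite^'b::finite"
  shows "X \<bullet> Y = trace (transpose X ** Y)"
  by (simp add: trace_def inner_vec_def matrix_matrix_mult_def transpose_def)
     (rule sum.swap)

lemma spectral_mult_vec:
  "spectral u l *v x = (\<Sum>i\<in>UNIV. (l i * (u i \<bullet> x)) *\<^sub>R u i)"
proof -
  have "(spectral u l *v x) $ k = (\<Sum>i\<in>UNIV. (l i * (u i \<bullet> x)) *\<^sub>R u i) $ k" for k
    by (simp add: spectral_def matrix_vector_mult_def inner_vec_def sum_distrib_left sum_distrib_right mult_ac)
       (rule sum.swap)
  then show ?thesis by (simp add: vec_eq_iff)
qed

lemma eigenbasis_spectral: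
  assumes "orthonormal_basis u"
  shows "eigenbasis u l (spectral u l)"
  using assms
  by (auto simp: eigenbasis_def spectral_mult_vec orthonormal_basis_def if_distrib[where f="\<lambda>x. _ * x"]
      if_distrib[where f="\<lambda>x. x *\<^sub>R _"] cong: if_cong)

lemma eigenbasis_unique:
  assumes "eigenbasis u l X" "eigenbasis u l Y"
  shows "X = Y"
  using assms by (intro matrix_eqI_orthonormal_basis[of u]) (auto simp: eigenbasis_def)

lemma eigenbasis_eq_spectral: "eigenbasis u l X \<Longrightarrow> X = spectral u l"
  by (meson eigenbasisD(1) eigenbasis_spectral eigenbasis_unique)

lemma transpose_spectral: "transpose (spectral u l) = spectral u l"
  by (simp add: transpose_def spectral_def vec_eq_iff mult_ac)

lemma eigenbasis_symmetric: "eigenbasis u l X \<Longrightarrow> transpose X = X"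
  using eigenbasis_eq_spectral transpose_spectral by metis

lemma eigenbasis_inner_left:
  assumes "eigenbasis u l X" shows "u i \<bullet> (X *v x) = l i * (u i \<bullet> x)"
  using assms eigenbasis_symmetric[OF assms] by (simp add: transpose_inner eigenbasisD)

lemma eigenbasis_mult:
  assumes "eigenbasis u l X" "eigenbasis u m Y"
  shows "eigenbasis u (\<lambda>i. l i * m i) (X ** Y)"
  using assms by (auto simp: eigenbasis_def simp flip: matrix_vector_mul_assoc
       simp: matrix_vector_mult_scaleR)

lemma eigenbasis_mat1: "orthonormal_basis u \<Longrightarrow> eigenbasis u (\<lambda>_. 1) (mat 1)"
  by (simp add: eigenbasis_def)

lemma eigenbasis_scaleR: "eigenbasis u l X \<Longrightarrow> eigenbasis u (\<lambda>i. c * l i) (c *\<^sub>R X)"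
  by (simp add: eigenbasis_def scaleR_matrix_vector_assoc[symmetric])

lemma eigenbasis_diff:
  assumes "eigenbasis u l X" "eigenbasis u m Y"
  shows "eigenbasis u (\<lambda>i. l i - m i) (X - Y)"
  using assms by (simp add: eigenbasis_def matrix_vector_mult_diff_rdistrib scaleR_diff_left)

lemma eigenbasis_add:
  assumes "eigenbasis u l X" "eigenbasis u m Y"
  shows "eigenbasis u (\<lambda>i. l i + m i) (X + Y)"
  using assms by (simp add: eigenbasis_def matrix_vector_mult_add_rdistrib scaleR_add_left)

text \<open>
Each factor of $u_i \cdot (X - Y) v_j$ meets its own eigenvector, so the entry is an exact
difference of eigenvalues.
\<close>

lemma two_eigenbases:
  assumes "eigenbasis u l X" "eigenbasis v m Y"
  shows "u i \<bullet> ((X - Y) *v v j) = (l i - m j) * (u i \<bullet> v j)"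
  using assms by (simp add: matrix_vector_mult_diff_rdistrib inner_diff_right eigenbasis_inner_left eigenbasisD algebra_simps)

text \<open>
The functional calculus does not depend on the chosen eigenbasis: where $l_i \ne m_j$ the vectors
$u_i$ and $v_j$ are orthogonal, and elsewhere $f$ takes the same value. This gives uniqueness
of the logarithm and of the positive square root.
\<close>

lemma eigenbasis_fun_cong:
  assumes X: "eigenbasis u l X" and Y: "eigenbasis v m X"
    and X': "eigenbasis u (\<lambda>i. f (l i)) X'" and Y': "eigenbasis v (\<lambda>i. f (m i)) Y'"
  shows "X' = Y'"
proof (rule matrix_eqI_orthonormal_basis[OF eigenbasisD(1)[OF Y]])
  fix j
  show "X' *v v j = Y' *v v j"
  proof (rule vec_eqI_orthonormal_basis[OF eigenbasisD(1)[OF X]])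
    fix i
    have "l i = m j \<or> u i \<bullet> v j = 0"
      using two_eigenbases[OF X Y, of i j] by simp
    then show "u i \<bullet> (X' *v v j) = u i \<bullet> (Y' *v v j)"
      by (auto simp: eigenbasis_inner_left[OF X'] eigenbasisD[OF Y'])
  qed
qed

text \<open>
The orthogonal complement of a set of eigenvectors is invariant, and a maximizer of the
Rayleigh quotient on its unit sphere is again an eigenvector.
\<close>

lemma symmetric_eigenvector_orthogonal_complement:
  fixes X :: "real^'a::finite^'a"
  assumes sym: "transpose X = X" and fin: "finite B" and small: "card B < CARD('a)"
    and eig: "\<And>b. b \<in> B \<Longrightarrow> \<exists>c. X *v b = c *\<^sub>R b"
  obtains v c where "norm v = 1" "X *v v = c *\<^sub>R v" "\<And>b. b \<in> B \<Longrightarrow> b \<bullet> v = 0"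
proof -
  define S where "S = {x. \<forall>b\<in>B. b \<bullet> x = 0}"
  have subS: "subspace S"
    by (auto simp: S_def subspace_def inner_add_right)
  have "dim (span B) < DIM(real^'a)"
    using small dim_le_card'[OF fin] by simp
  then obtain z where z: "z \<noteq> 0" "\<forall>b\<in>span B. orthogonal z b"
    using orthogonal_to_subspace_exists by (metis dim_span)
  have zS: "z \<in> S" using z by (auto simp: S_def orthogonal_def span_base inner_commute)
  define K where "K = S \<inter> sphere 0 1"
  have "closed S" using subS by (rule closed_subspace)
  then have "compact K" unfolding K_def by (simp add: closed_Int_compact)
  moreover have "(1 / norm z) *\<^sub>R z \<in> K"
    using z zS subS by (simp add: K_def subspace_def)
  moreover have "continuous_on K (\<lambda>x. x \<bullet> (X *v x))"
    by (intro continuous_intros linear_continuous_on matrix_vector_mul_bounded_linear)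
  ultimately obtain v where v: "v \<in> K" "\<And>y. y \<in> K \<Longrightarrow> y \<bullet> (X *v y) \<le> v \<bullet> (X *v v)"
    using continuous_attains_sup[of K "\<lambda>x. x \<bullet> (X *v x)"] by blast
  define \<mu> where "\<mu> = v \<bullet> (X *v v)"
  have nv: "norm v = 1" "v \<bullet> v = 1" and vS: "v \<in> S"
    using v(1) by (auto simp: K_def norm_eq_1)
  have inv: "X *v x \<in> S" if "x \<in> S" for x
    unfolding S_def
  proof safe
    fix b assume b: "b \<in> B"
    from eig[OF b] obtain c where "X *v b = c *\<^sub>R b" ..
    then show "b \<bullet> (X *v x) = 0" using that b by (simp add: transpose_inner sym S_def)
  qed
  have bound: "y \<bullet> (X *v y) \<le> \<mu> * (y \<bullet> y)" if "y \<in> S" for y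
  proof (cases "y = 0")
    case False
    have "(1 / norm y) *\<^sub>R y \<in> K" using False that subS by (simp add: K_def subspace_def)
    from v(2)[OF this] have "(y \<bullet> (X *v y)) / (norm y)\<^sup>2 \<le> \<mu>"
      by (simp add: matrix_vector_mult_scaleR \<mu>_def power2_eq_square)
    then show ?thesis using False by (simp add: field_simps power2_norm_eq_inner)
  qed auto
  define w where "w = X *v v - \<mu> *\<^sub>R v"
  have wS: "w \<in> S" unfolding w_def using subS inv[OF vS] vS
    by (intro subspace_diff subspace_scale)
  have "w \<bullet> v = (X *v v) \<bullet> v - \<mu> * (v \<bullet> v)" by (simp add: w_def inner_diff_left)
  then have wv: "w \<bullet> v = 0" by (simp add: nv \<mu>_def inner_commute)
  have wX: "w \<bullet> (X *v v) = w \<bullet> w"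
    using wv by (simp add: w_def inner_diff_right)
  have vXw: "v \<bullet> (X *v w) = w \<bullet> w"
    using wX by (simp add: transpose_inner[of v X w] sym inner_commute)
  define c where "c = \<mu> * (w \<bullet> w) - w \<bullet> (X *v w)"
  have ineq: "2 * t * (w \<bullet> w) \<le> t\<^sup>2 * c" for t
  proof -
    have "v + t *\<^sub>R w \<in> S" using subS vS wS by (intro subspace_add subspace_scale)
    from bound[OF this] show ?thesis
      using wX wv nv vXw
      by (simp add: c_def flip: \<mu>_def add: matrix_vector_right_distrib matrix_vector_mult_scaleR inner_add_left inner_add_right
          inner_commute[of v w] power2_eq_square algebra_simps)
  qed
  have "w \<bullet> w = 0"
  proof (rule ccontr)
    assume "w \<bullet> w \<noteq> 0"
    then have pos: "w \<bullet> w > 0" by simp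
    \<comment> \<open>For this step the first-order gain exceeds the second-order loss; the summand 1 covers the case c = 0.\<close>
    define t where "t = (w \<bullet> w) / (\<bar>c\<bar> + 1)"
    have t: "t > 0" using pos by (simp add: t_def add_pos_nonneg)
    have "2 * (w \<bullet> w) \<le> t * c" using ineq[of t] t by (simp add: power2_eq_square)
    also have "\<dots> \<le> t * (\<bar>c\<bar> + 1)" using t by (intro mult_left_mono) auto
    also have "\<dots> = w \<bullet> w" by (simp add: t_def add_nonneg_eq_0_iff)
    finally show False using pos by simp
  qed
  then have "X *v v = \<mu> *\<^sub>R v" by (simp add: w_def)
  then show ?thesis using that nv vS by (auto simp: S_def)
qed

lemma symmetric_orthonormal_eigenvectors:
  fixes X :: "real^'a::finite^'a"
  assumes sym: "transpose X = X" and "finite I"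
  shows "\<exists>u l. (\<forall>i\<in>I. \<forall>j\<in>I. u i \<bullet> u j = (if i = j then 1 else 0)) \<and> (\<forall>i\<in>I. X *v u i = l i *\<^sub>R (u (i::'a)))"
  using assms(2)
proof (induction I rule: finite_induct)
  case (insert k I)
  then obtain u l where u: "\<And>i j. i \<in> I \<Longrightarrow> j \<in> I \<Longrightarrow> u i \<bullet> u j = (if i = j then 1 else 0)"
    and l: "\<And>i. i \<in> I \<Longrightarrow> X *v u i = l i *\<^sub>R u i" by blast
  have "card (u ` I) \<le> card I" using insert by (simp add: card_image_le)
  also have "\<dots> < CARD('a)" using insert by (intro psubset_card_mono) auto
  finally have "card (u ` I) < CARD('a)" .
  moreover have "\<exists>c. X *v b = c *\<^sub>R b" if "b \<in> u ` I" for b using that l by auto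
  ultimately obtain v c where v: "norm v = 1" "X *v v = c *\<^sub>R v" "\<And>b. b \<in> u ` I \<Longrightarrow> b \<bullet> v = 0"
    using symmetric_eigenvector_orthogonal_complement[OF sym finite_imageI[OF insert.hyps(1)]] by blast
  have "v \<bullet> v = 1" using v(1) by (simp add: norm_eq_1)
  moreover have "u i \<bullet> v = 0" "v \<bullet> u i = 0" if "i \<in> I" for i
    using v(3)[of "u i"] that by (auto simp: inner_commute)
  ultimately show ?case using insert.hyps u l v
    by (intro exI[of _ "u(k := v)"] exI[of _ "l(k := c)"]) auto
qed auto

theorem spectral_theorem:
  fixes X :: "real^'a::finite^'a"
  assumes "transpose X = X"
  obtains u l where "eigenbasis u l X"
  using symmetric_orthonormal_eigenvectors[OF assms, of UNIV]
  by (auto simp: eigenbasis_def orthonormal_basis_def)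

section \<open>Exponential, logarithm and square root\<close>

lemma eigenbasis_matrix_power:
  "eigenbasis u l X \<Longrightarrow> eigenbasis u (\<lambda>i. l i ^ k) (((**) X ^^ k) (mat 1))"
  by (induction k) (auto intro: eigenbasis_mult eigenbasis_mat1 eigenbasisD)

text \<open>
Every term of the exponential series is diagonal in the eigenbasis, so the series converges
because the scalar ones do.
\<close>

lemma eigenbasis_mexp:
  assumes "eigenbasis u l X"
  shows "eigenbasis u (\<lambda>i. exp (l i)) (mexp X)"
proof -
  have 1: "(1 / fact k) *\<^sub>R (((**) X ^^ k) (mat 1)) =
     (\<Sum>i\<in>UNIV. (l i ^ k /\<^sub>R fact k) *\<^sub>R (\<chi> a b. u i $ a * u i $ b))" for k
    by (subst eigenbasis_eq_spectral[OF eigenbasis_matrix_power[OF assms]])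
       (simp add: spectral_def scaleR_sum_right divide_inverse)
  have "(\<lambda>k. (1 / fact k) *\<^sub>R (((**) X ^^ k) (mat 1))) sums spectral u (\<lambda>i. exp (l i))"
    unfolding 1 spectral_def
    by (intro sums_sum sums_scaleR_left exp_converges)
  then have "mexp X = spectral u (\<lambda>i. exp (l i))"
    unfolding mexp_def by (rule sums_unique[symmetric])
  then show ?thesis using assms by (simp add: eigenbasis_spectral eigenbasisD)
qed

lemma eigenbasis_inner_quadratic:
  assumes "eigenbasis u l P"
  shows "x \<bullet> (P *v x) = (\<Sum>i\<in>UNIV. l i * (u i \<bullet> x)\<^sup>2)"
  by (subst inner_orthonormal_basis[OF eigenbasisD(1)[OF assms]])
     (simp add: eigenbasis_inner_left[OF assms] power2_eq_square mult_ac)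

lemma spd_eigenbasis_iff:
  assumes "eigenbasis u l P"
  shows "P \<in> spd \<longleftrightarrow> (\<forall>i. l i > 0)"
proof
  assume P: "P \<in> spd"
  show "\<forall>i. l i > 0"
  proof
    fix i
    have "u i \<bullet> u i = 1" using assms by (simp add: eigenbasis_def orthonormal_basis_def)
    moreover from this have "u i \<noteq> 0" by auto
    ultimately show "l i > 0"
      using P by (auto simp: spd_def eigenbasisD[OF assms] dest: spec[of _ "u i"])
  qed
next
  assume l: "\<forall>i. l i > 0"
  have "x \<bullet> (P *v x) > 0" if x: "x \<noteq> 0" for x
  proof -
    have "\<exists>i. u i \<bullet> x \<noteq> 0"
    proof (rule ccontr)
      assume "\<nexists>i. u i \<bullet> x \<noteq> 0"
      then have "x = 0" by (intro vec_eqI_orthonormal_basis[OF eigenbasisD(1)[OF assms]]) auto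
      with x show False by simp
    qed
    then obtain i where "u i \<bullet> x \<noteq> 0" ..
    then show ?thesis using l unfolding eigenbasis_inner_quadratic[OF assms]
      by (intro sum_pos2[of _ i]) (auto simp: less_imp_le intro!: mult_nonneg_nonneg)
  qed
  then show "P \<in> spd" using eigenbasis_symmetric[OF assms] by (simp add: spd_def)
qed

lemma mlog_mexp:
  assumes "transpose X = X" shows "mlog (mexp X) = X"
  unfolding mlog_def
proof (rule the_equality)
  fix Y assume Y: "transpose Y = Y \<and> mexp Y = mexp X"
  obtain u l where X: "eigenbasis u l X" using spectral_theorem[OF assms] .
  obtain v m where m: "eigenbasis v m Y" using spectral_theorem Y by blast
  show "Y = X"
  proof (rule eigenbasis_fun_cong[where f = ln])
    show "eigenbasis v (\<lambda>i. exp (m i)) (mexp X)" using eigenbasis_mexp[OF m] Y by simp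
    show "eigenbasis u (\<lambda>i. exp (l i)) (mexp X)" by (rule eigenbasis_mexp[OF X])
  qed (use m X in simp_all)
qed (use assms in simp)

lemma mexp_spd:
  assumes "transpose X = X" shows "mexp X \<in> spd"
proof -
  obtain u l where X: "eigenbasis u l X" using spectral_theorem[OF assms] .
  show ?thesis using spd_eigenbasis_iff[OF eigenbasis_mexp[OF X]] by simp
qed

lemma spd_symmetric: "P \<in> spd \<Longrightarrow> transpose P = P" by (simp add: spd_def)

lemma spd_eigenbasis:
  assumes "P \<in> spd"
  obtains u l where "eigenbasis u l P" "\<And>i. l i > 0"
proof -
  obtain u l where "eigenbasis u l P" using spectral_theorem[OF spd_symmetric[OF assms]] .
  then show ?thesis using that assms spd_eigenbasis_iff by blast
qed

lemma spd_mexpE: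
  assumes "P \<in> spd"
  obtains X where "transpose X = X" "mexp X = P" "mlog P = X"
proof -
  obtain u l where u: "eigenbasis u l P" "\<And>i. l i > 0" by (rule spd_eigenbasis[OF assms]) blast
  define X where "X = spectral u (\<lambda>i. ln (l i))"
  have X: "eigenbasis u (\<lambda>i. ln (l i)) X" unfolding X_def
    using u eigenbasisD eigenbasis_spectral by blast
  have "mexp X = P" using eigenbasis_mexp[OF X] u by (auto intro: eigenbasis_unique)
  then show ?thesis using that mlog_mexp X eigenbasis_symmetric by blast
qed

lemma mexp_mlog: "P \<in> spd \<Longrightarrow> mexp (mlog P) = P"
  and mlog_symmetric: "P \<in> spd \<Longrightarrow> transpose (mlog P) = mlog P"
  using spd_mexpE[of P] by auto

text \<open>
Multiples of one symmetric matrix share an eigenbasis, which makes $t \mapsto e^{tX}$ a group of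
matrices. All geodesic reparametrizations below use only this.
\<close>

lemma mexp_add_commuting_scale:
  assumes "transpose X = X"
  shows "mexp (s *\<^sub>R X) ** mexp (t *\<^sub>R X) = mexp ((s + t) *\<^sub>R X)"
proof -
  obtain u l where X: "eigenbasis u l X" using spectral_theorem[OF assms] .
  show ?thesis
    using eigenbasis_mult[OF eigenbasis_mexp[OF eigenbasis_scaleR[OF X, of s]] eigenbasis_mexp[OF eigenbasis_scaleR[OF X, of t]]]
      eigenbasis_mexp[OF eigenbasis_scaleR[OF X, of "s + t"]]
    by (auto intro!: eigenbasis_unique simp: exp_add distrib_right)
qed

lemma mexp_zero [simp]: "mexp 0 = mat 1"
proof -
  obtain u l where "eigenbasis u l (0::real^'a^'a)" using spectral_theorem[of "0::real^'a^'a"]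
    by (auto simp: transpose_def vec_eq_iff)
  then have "eigenbasis u (\<lambda>_. 0) (0::real^'a^'a)" by (simp add: eigenbasis_def)
  from eigenbasis_mexp[OF this] show ?thesis
    using eigenbasis_mat1 eigenbasisD(1) eigenbasis_unique by fastforce
qed

lemma mexp_minus_inverse:
  assumes "transpose X = X"
  shows "mexp X ** mexp (- X) = mat 1" "mexp (- X) ** mexp X = mat 1"
  using mexp_add_commuting_scale[OF assms, of 1 "-1"] mexp_add_commuting_scale[OF assms, of "-1" 1] by auto

lemma mexp_half:
  assumes "transpose X = X"
  shows "mexp ((1/2) *\<^sub>R X) ** mexp ((1/2) *\<^sub>R X) = mexp X"
  using mexp_add_commuting_scale[OF assms, of "1/2" "1/2"] by simp

lemma transpose_scaleR [simp]: "transpose (c *\<^sub>R X) = c *\<^sub>R transpose X"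
  by (simp add: transpose_def vec_eq_iff)
lemma transpose_add: "transpose (X + Y) = transpose X + transpose (Y::real^'a^'b)"
  by (simp add: transpose_def vec_eq_iff)
lemma transpose_minus: "transpose (- X) = - transpose (X::real^'a^'b)"
  by (simp add: transpose_def vec_eq_iff)

lemma msqrt_unique:
  assumes "S \<in> spd" shows "msqrt (S ** S) = S"
  unfolding msqrt_def
proof (rule the_equality)
  fix Y assume Y: "Y \<in> spd \<and> Y ** Y = S ** S"
  obtain u l where X: "eigenbasis u l S" "\<And>i. l i > 0" using spd_eigenbasis assms by blast
  obtain v m where m: "eigenbasis v m Y" "\<And>i. m i > 0" using spd_eigenbasis Y by blast
  show "Y = S"
  proof (rule eigenbasis_fun_cong[where f = sqrt])
    show "eigenbasis v (\<lambda>i. m i * m i) (S ** S)" using eigenbasis_mult[OF m(1) m(1)] Y by simp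
    show "eigenbasis u (\<lambda>i. l i * l i) (S ** S)" by (rule eigenbasis_mult[OF X(1) X(1)])
  qed (use m X in \<open>simp_all add: less_imp_le\<close>)
qed (use assms in simp)

lemma msqrt_mexp: "transpose X = X \<Longrightarrow> msqrt (mexp X) = mexp ((1/2) *\<^sub>R X)"
  by (metis mexp_half mexp_spd msqrt_unique transpose_scaleR)

lemma msqrt_spd_square:
  assumes "P \<in> spd" shows "msqrt P \<in> spd" "msqrt P ** msqrt P = P"
proof -
  obtain X where "transpose X = X" "mexp X = P" using spd_mexpE[OF assms] by blast
  then show "msqrt P \<in> spd" "msqrt P ** msqrt P = P"
    using msqrt_mexp[of X] mexp_half[of X] mexp_spd[of "(1/2) *\<^sub>R X"] by auto
qed

lemma spd_invertible:
  assumes "P \<in> spd" shows "invertible P"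
  unfolding invertible_def
  using mexp_minus_inverse[OF mlog_symmetric[OF assms]] mexp_mlog[OF assms] by auto

lemma matrix_inv_inverse:
  assumes "invertible (P::real^'a::finite^'a)"
  shows "P ** matrix_inv P = mat 1" "matrix_inv P ** P = mat 1"
  using someI_ex[OF assms[unfolded invertible_def]] by (auto simp: matrix_inv_def)

lemma spd_matrix_inv:
  assumes "P \<in> spd" shows "matrix_inv P \<in> spd" "P ** matrix_inv P = mat 1" "matrix_inv P ** P = mat 1"
proof -
  show 1: "P ** matrix_inv P = mat 1" "matrix_inv P ** P = mat 1"
    using spd_invertible[OF assms] by (auto simp: matrix_inv_inverse)
  obtain X where X: "transpose X = X" "mexp X = P" using spd_mexpE[OF assms] by blast
  have "matrix_inv P = mexp (- X)"
    using 1 mexp_minus_inverse[OF X(1)] X(2)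
    by (metis (no_types) matrix_mul_assoc matrix_mul_lid matrix_mul_rid)
  then show "matrix_inv P \<in> spd" using X by (simp add: mexp_spd transpose_minus)
qed

text \<open>
The eigenvectors are the columns of an invertible matrix that conjugates $X$ to a diagonal one.
\<close>

lemma det_eigenbasis:
  assumes "eigenbasis u l X" shows "det X = (\<Prod>i\<in>UNIV. l i)"
proof -
  define U where "U = transpose (\<chi> i. u i)"
  define D where "D = (\<chi> i j. if i = j then l i else (0::real))"
  have UU: "transpose U ** U = mat 1"
    using eigenbasisD(1)[OF assms]
    by (simp add: U_def vec_eq_iff matrix_matrix_mult_def transpose_def mat_def
        inner_vec_def orthonormal_basis_def)
  have "X ** U = U ** D"
  proof -
    have "(X ** U) $ a $ b = (U ** D) $ a $ b" for a b
    proof -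
      have "(X ** U) $ a $ b = (X *v u b) $ a"
        by (simp add: matrix_matrix_mult_def U_def transpose_def matrix_vector_mult_def)
      also have "\<dots> = (U ** D) $ a $ b"
        by (simp add: eigenbasisD(2)[OF assms] matrix_matrix_mult_def U_def transpose_def D_def
           if_distrib[where f="\<lambda>x. _ * x"] cong: if_cong)
      finally show ?thesis .
    qed
    then show ?thesis by (simp add: vec_eq_iff)
  qed
  then have "det X * det U = det U * det D" by (metis det_mul)
  moreover have "det U \<noteq> 0" using UU by (metis det_I det_mul mult_zero_right zero_neq_one)
  moreover have "det D = (\<Prod>i\<in>UNIV. l i)" by (subst det_diagonal) (auto simp: D_def)
  ultimately show ?thesis by simp
qed

lemma det_mexp:
  assumes "transpose X = X" shows "det (mexp X) = exp (trace X)"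
proof -
  obtain u l where X: "eigenbasis u l X" using spectral_theorem[OF assms] .
  have "u i \<bullet> u i = 1" for i using eigenbasisD(1)[OF X] by (simp add: orthonormal_basis_def)
  then have "trace X = (\<Sum>i\<in>UNIV. l i)"
    by (simp add: trace_orthonormal_basis[OF eigenbasisD(1)[OF X]] eigenbasisD(2)[OF X])
  then show ?thesis by (simp add: det_eigenbasis[OF eigenbasis_mexp[OF X]] exp_sum)
qed

lemma spd_det_pos: "P \<in> spd \<Longrightarrow> det P > 0"
  using det_mexp[OF mlog_symmetric, of P] mexp_mlog[of P] by simp

lemma spd_congruence:
  fixes P :: "real^'a::finite^'a" and Z :: "real^'a^'b::finite"
  assumes "P \<in> spd" "\<And>x. x \<noteq> 0 \<Longrightarrow> transpose Z *v x \<noteq> 0"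
  shows "Z ** P ** transpose Z \<in> spd"
proof -
  have "x \<bullet> ((Z ** P ** transpose Z) *v x) = (transpose Z *v x) \<bullet> (P *v (transpose Z *v x))" for x
    by (simp add: transpose_inner[of x Z] matrix_vector_mul_assoc[symmetric])
  then show ?thesis
    using assms by (simp add: spd_def matrix_transpose_mul matrix_mul_assoc)
qed

lemma spd_congruence_invertible:
  fixes P Z :: "real^'a::finite^'a"
  assumes "P \<in> spd" "invertible Z"
  shows "Z ** P ** transpose Z \<in> spd"
proof (rule spd_congruence[OF assms(1)])
  fix x :: "real^'a" assume "x \<noteq> 0"
  moreover have "invertible (transpose Z)" using assms(2) transpose_invertible by blast
  ultimately show "transpose Z *v x \<noteq> 0"
    by (metis invertible_left_inverse matrix_left_invertible_ker)
qed

section \<open>The affine-invariant distance\<close>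

lemma eigenbasis_mlog:
  assumes "eigenbasis u l P" "\<And>i. l i > 0"
  shows "eigenbasis u (\<lambda>i. ln (l i)) (mlog P)"
proof -
  have X: "eigenbasis u (\<lambda>i. ln (l i)) (spectral u (\<lambda>i. ln (l i)))"
    using assms(1) by (intro eigenbasis_spectral eigenbasisD)
  have "mexp (spectral u (\<lambda>i. ln (l i))) = P"
    using eigenbasis_mexp[OF X] assms by (auto intro: eigenbasis_unique)
  with mlog_mexp[OF eigenbasis_symmetric[OF X]] X show ?thesis by simp
qed

lemma norm2_eigenbasis:
  assumes "eigenbasis u l X" shows "(norm X)\<^sup>2 = (\<Sum>i\<in>UNIV. (l i)\<^sup>2)"
  unfolding norm2_matrix_two_bases[OF eigenbasisD(1)[OF assms] eigenbasisD(1)[OF assms]]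
  using eigenbasisD(1)[OF assms]
  by (simp add: eigenbasisD(2)[OF assms] orthonormal_basis_def if_distrib[where f="\<lambda>x. _ * x"]
     if_distrib[where f="\<lambda>x. x\<^sup>2"] cong: if_cong)

lemma eigenbasis_orthogonal_conj:
  assumes "eigenbasis u l P" "transpose Q ** Q = mat 1"
  shows "eigenbasis (\<lambda>i. Q *v u i) l (Q ** P ** transpose Q)"
proof -
  have "(Q *v x) \<bullet> (Q *v y) = x \<bullet> y" for x y
    by (simp add: transpose_inner matrix_vector_mul_assoc assms(2))
  moreover have "Q ** P ** transpose Q *v (Q *v x) = Q *v (P *v x)" for x
    by (simp add: matrix_vector_mul_assoc matrix_mul_assoc[symmetric] assms(2))
  ultimately show ?thesis using assms(1)
    by (simp add: eigenbasis_def orthonormal_basis_def matrix_vector_mult_scaleR)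
qed

lemma norm_mlog_orthogonal_conj:
  fixes P Q :: "real^'a::finite^'a"
  assumes "P \<in> spd" "transpose Q ** Q = mat 1"
  shows "norm (mlog (Q ** P ** transpose Q)) = norm (mlog P)"
proof -
  obtain u l where u: "eigenbasis u l P" "\<And>i. l i > 0" by (rule spd_eigenbasis[OF assms(1)]) blast
  have "(norm (mlog (Q ** P ** transpose Q)))\<^sup>2 = (norm (mlog P))\<^sup>2"
    using norm2_eigenbasis[OF eigenbasis_mlog[OF eigenbasis_orthogonal_conj[OF u(1) assms(2)] u(2)]]
      norm2_eigenbasis[OF eigenbasis_mlog[OF u]] by simp
  then show ?thesis by simp
qed

lemma msqrt_inverse_whitens:
  assumes "P \<in> spd"
  defines "Z \<equiv> matrix_inv (msqrt P)"
  shows "Z \<in> spd" "transpose Z = Z" "Z ** P ** Z = mat 1" "Z ** msqrt P = mat 1" "msqrt P ** Z = mat 1"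
proof -
  note S = msqrt_spd_square[OF assms(1)]
  note Z = spd_matrix_inv[OF S(1), folded Z_def]
  show "Z \<in> spd" "Z ** msqrt P = mat 1" "msqrt P ** Z = mat 1" by (rule Z)+
  show "transpose Z = Z" using Z(1) by (rule spd_symmetric)
  have "Z ** P ** Z = (Z ** msqrt P) ** (msqrt P ** Z)"
    by (subst S(2)[symmetric]) (simp add: matrix_mul_assoc)
  then show "Z ** P ** Z = mat 1" using Z by simp
qed

text \<open>
Any matrix that carries $P$ to the identity may replace $P^{-1/2}$ in the definition of the
distance: two such matrices differ by an orthogonal factor, which does not change the norm of the
logarithm. Congruence invariance and symmetry of the distance follow from this.
\<close>

lemma d_AI_whiten:
  fixes P P' Z :: "real^'a::finite^'a"
  assumes P: "P \<in> spd" and P': "P' \<in> spd" and Z: "Z ** P ** transpose Z = mat 1"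
  shows "d_AI P P' = norm (mlog (Z ** P' ** transpose Z))"
proof -
  define S where "S = msqrt P"
  define Y where "Y = matrix_inv S"
  note Y = msqrt_inverse_whitens[OF P, folded S_def, folded Y_def]
  have S: "S \<in> spd" "S ** S = P" using msqrt_spd_square[OF P] by (auto simp: S_def)
  define Q where "Q = Z ** S"
  have "Q ** transpose Q = Z ** (S ** S) ** transpose Z"
    using spd_symmetric[OF S(1)] by (simp add: Q_def matrix_transpose_mul matrix_mul_assoc)
  then have "Q ** transpose Q = mat 1" using Z S by simp
  then have Q: "transpose Q ** Q = mat 1" using matrix_left_right_inverse by blast
  have QY: "Q ** Y = Z" using Y(5) by (simp add: Q_def matrix_mul_assoc[symmetric])
  have YQ: "Y ** transpose Q = transpose Z"
    using arg_cong[OF QY, of transpose] Y(2) by (simp add: matrix_transpose_mul)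
  have "Q ** (Y ** P' ** Y) ** transpose Q = (Q ** Y) ** P' ** (Y ** transpose Q)"
    by (simp add: matrix_mul_assoc)
  then have eq: "Q ** (Y ** P' ** Y) ** transpose Q = Z ** P' ** transpose Z"
    by (simp add: QY YQ)
  have "Y ** P' ** transpose Y \<in> spd"
    using P' Y(1) by (intro spd_congruence_invertible spd_invertible)
  then have "Y ** P' ** Y \<in> spd" using Y(2) by simp
  from norm_mlog_orthogonal_conj[OF this Q] show ?thesis
    by (simp add: eq d_AI_def S_def[symmetric] Y_def[symmetric])
qed

lemma d_AI_congruence:
  fixes P P' Z :: "real^'a::finite^'a"
  assumes P: "P \<in> spd" and P': "P' \<in> spd" and Z: "invertible Z"
  shows "d_AI (Z ** P ** transpose Z) (Z ** P' ** transpose Z) = d_AI P P'"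
proof -
  define Y where "Y = matrix_inv (msqrt P)"
  note Y = msqrt_inverse_whitens[OF P, folded Y_def]
  define X where "X = Y ** matrix_inv Z"
  have XZ: "X ** Z = Y" by (simp add: X_def matrix_mul_assoc[symmetric] matrix_inv_inverse[OF Z])
  have ZX: "transpose Z ** transpose X = Y"
    by (simp add: matrix_transpose_mul[symmetric] XZ Y)
  have eq: "X ** (Z ** A ** transpose Z) ** transpose X = Y ** A ** Y" for A
  proof -
    have "X ** (Z ** A ** transpose Z) ** transpose X = (X ** Z) ** A ** (transpose Z ** transpose X)"
      by (simp add: matrix_mul_assoc)
    then show ?thesis by (simp add: XZ ZX)
  qed
  show ?thesis
    by (subst d_AI_whiten[where Z = X])
       (simp_all add: eq Y assms spd_congruence_invertible d_AI_def Y_def[symmetric])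
qed

lemma mat1_spd: "mat 1 \<in> spd"
  by (simp add: spd_def)

lemma d_AI_identity_mexp:
  assumes "transpose H = H" shows "d_AI (mat 1) (mexp H) = norm H"
  by (subst d_AI_whiten[where Z = "mat 1"]) (simp_all add: mat1_spd mexp_spd assms mlog_mexp)

lemma mexp_congruence_path:
  assumes "transpose X = X"
  shows "mexp (s *\<^sub>R X) ** (mexp (t *\<^sub>R X) ** A ** mexp (t *\<^sub>R X)) ** mexp (s *\<^sub>R X)
     = mexp ((s + t) *\<^sub>R X) ** A ** mexp ((s + t) *\<^sub>R X)"
proof -
  have "mexp (s *\<^sub>R X) ** (mexp (t *\<^sub>R X) ** A ** mexp (t *\<^sub>R X)) ** mexp (s *\<^sub>R X)
   = (mexp (s *\<^sub>R X) ** mexp (t *\<^sub>R X)) ** A ** (mexp (t *\<^sub>R X) ** mexp (s *\<^sub>R X))"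
    by (simp add: matrix_mul_assoc)
  then show ?thesis by (simp add: mexp_add_commuting_scale[OF assms] add.commute)
qed

lemma mexp_congruence_spd:
  assumes "transpose X = X" "R \<in> spd" shows "mexp X ** R ** mexp X \<in> spd"
  using spd_congruence_invertible[OF assms(2) spd_invertible[OF mexp_spd[OF assms(1)]]]
    spd_symmetric[OF mexp_spd[OF assms(1)]] by simp

lemma d_AI_mexp:
  assumes "transpose X = X" "R \<in> spd"
  shows "d_AI (mexp X) R = norm (mlog (mexp ((-1/2) *\<^sub>R X) ** R ** mexp ((-1/2) *\<^sub>R X)))"
proof -
  have *: "transpose (mexp ((-1/2) *\<^sub>R X)) = mexp ((-1/2) *\<^sub>R X)"
    using assms by (intro spd_symmetric[OF mexp_spd]) (simp add: transpose_minus)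
  have "mexp ((-1/2) *\<^sub>R X) ** mexp (1 *\<^sub>R X) ** mexp ((-1/2) *\<^sub>R X) = mat 1"
    unfolding mexp_add_commuting_scale[OF assms(1)] by simp
  then have "mexp ((-1/2) *\<^sub>R X) ** mexp X ** transpose (mexp ((-1/2) *\<^sub>R X)) = mat 1"
    unfolding * by simp
  from d_AI_whiten[OF mexp_spd[OF assms(1)] assms(2) this] show ?thesis unfolding * .
qed

text \<open>
Coordinates for the other endpoint of a geodesic: the whitened logarithm is the initial velocity.
\<close>

lemma geodesic_to:
  assumes P: "P \<in> spd" and P': "P' \<in> spd"
  defines "H \<equiv> mlog (matrix_inv (msqrt P) ** P' ** matrix_inv (msqrt P))"
  shows "transpose H = H" "msqrt P ** mexp H ** msqrt P = P'" "d_AI P P' = norm H"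
proof -
  define Y where "Y = matrix_inv (msqrt P)"
  note Y = msqrt_inverse_whitens[OF P, folded Y_def]
  have "Y ** P' ** transpose Y \<in> spd"
    using P' Y(1) by (intro spd_congruence_invertible spd_invertible)
  then have *: "Y ** P' ** Y \<in> spd" using Y(2) by simp
  show "transpose H = H" unfolding H_def Y_def[symmetric] by (rule mlog_symmetric[OF *])
  have "msqrt P ** (Y ** P' ** Y) ** msqrt P = (msqrt P ** Y) ** P' ** (Y ** msqrt P)"
    by (simp add: matrix_mul_assoc)
  then show "msqrt P ** mexp H ** msqrt P = P'"
    unfolding H_def Y_def[symmetric] mexp_mlog[OF *] by (simp add: Y)
  show "d_AI P P' = norm H" by (simp add: d_AI_def H_def)
qed

lemma d_AI_geodesic:
  assumes P: "P \<in> spd" and H: "transpose H = H"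
  shows "d_AI P (msqrt P ** mexp H ** msqrt P) = norm H"
proof -
  note S = msqrt_spd_square[OF P]
  have "d_AI (msqrt P ** mat 1 ** transpose (msqrt P)) (msqrt P ** mexp H ** transpose (msqrt P)) = norm H"
    unfolding d_AI_congruence[OF mat1_spd mexp_spd[OF H] spd_invertible[OF S(1)]]
    by (rule d_AI_identity_mexp[OF H])
  then show ?thesis by (simp add: spd_symmetric[OF S(1)] S(2))
qed

text \<open>
Congruence by $P^{-1/2}$ reduces the claim to the pair $I$, $e^{H}$, for which both
distances are $\|H\|$.
\<close>

lemma d_AI_commute:
  assumes P: "P \<in> spd" and P': "P' \<in> spd"
  shows "d_AI P P' = d_AI P' P"
proof -
  define H where "H = mlog (matrix_inv (msqrt P) ** P' ** matrix_inv (msqrt P))"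
  note H = geodesic_to[OF P P', folded H_def]
  note S = msqrt_spd_square[OF P]
  have "d_AI P' P = d_AI (msqrt P ** mexp H ** transpose (msqrt P)) (msqrt P ** mat 1 ** transpose (msqrt P))"
    by (simp add: spd_symmetric[OF S(1)] S(2) H)
  also have "\<dots> = d_AI (mexp H) (mat 1)"
    by (rule d_AI_congruence[OF mexp_spd[OF H(1)] mat1_spd spd_invertible[OF S(1)]])
  also have "\<dots> = norm (mlog (mexp ((-1) *\<^sub>R H)))"
    unfolding d_AI_mexp[OF H(1) mat1_spd] matrix_mul_rid mexp_add_commuting_scale[OF H(1)] by simp
  also have "\<dots> = norm H"
    by (subst mlog_mexp) (simp_all add: H(1) transpose_minus)
  finally show ?thesis using H(3) by simp
qed

section \<open>The exponential map does not decrease distances\<close>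

lemma square_le_two_cosh: "(x::real)\<^sup>2 \<le> exp x + exp (- x) - 2"
proof -
  have "\<bar>x / 2\<bar> \<le> \<bar>(exp (x/2) - inverse (exp (x/2))) / 2\<bar>" by (rule real_le_abs_sinh)
  then have "(x / 2)\<^sup>2 \<le> ((exp (x/2) - inverse (exp (x/2))) / 2)\<^sup>2"
    by (simp only: abs_le_square_iff)
  also have "\<dots> = (exp (x/2) * exp (x/2) + exp (-(x/2)) * exp (-(x/2)) - 2 * (exp (x/2) * exp (-(x/2)))) / 4"
    by (simp add: power2_eq_square field_simps exp_minus)
  also have "\<dots> = (exp x + exp (-x) - 2) / 4"
    by (simp flip: exp_add)
  finally show ?thesis by (simp add: power2_eq_square)
qed

text \<open>
The scalar inequality $(h-k)^2 \le e^{h-k} + e^{k-h} - 2$ holds for each pair of eigenvalues;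
weighting it by $(u_i \cdot v_j)^2$ and summing turns the right-hand side into traces of products.
\<close>

lemma log_difference_bound:
  fixes H K :: "real^'a::finite^'a"
  assumes "transpose H = H" "transpose K = K"
  shows "(norm (H - K))\<^sup>2 \<le> mexp H \<bullet> mexp (- K) + mexp (- H) \<bullet> mexp K - 2 * (mat 1 \<bullet> (mat 1 :: real^'a^'a))"
proof -
  obtain u h where u: "eigenbasis u h H" using spectral_theorem[OF assms(1)] .
  obtain v k where v: "eigenbasis v k K" using spectral_theorem[OF assms(2)] .
  have u': "eigenbasis u (\<lambda>i. - h i) (- H)" using eigenbasis_scaleR[OF u, of "-1"] by simp
  have v': "eigenbasis v (\<lambda>i. - k i) (- K)" using eigenbasis_scaleR[OF v, of "-1"] by simp
  note B = eigenbasisD(1)[OF u] eigenbasisD(1)[OF v]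
  have ip: "X \<bullet> Y = (\<Sum>j\<in>UNIV. \<Sum>i\<in>UNIV. (a i * b j) * (u i \<bullet> v j)\<^sup>2)"
    if "eigenbasis u a X" "eigenbasis v b Y" for X Y a b
    unfolding matrix_inner_two_bases[OF B]
    by (simp add: eigenbasis_inner_left[OF that(1)] eigenbasisD[OF that(2)] power2_eq_square mult_ac)
  have "(norm (H - K))\<^sup>2 = (\<Sum>j\<in>UNIV. \<Sum>i\<in>UNIV. (h i - k j)\<^sup>2 * (u i \<bullet> v j)\<^sup>2)"
    unfolding norm2_matrix_two_bases[OF B] by (simp add: two_eigenbases[OF u v] power_mult_distrib)
  also have "\<dots> \<le> (\<Sum>j\<in>UNIV. \<Sum>i\<in>UNIV. (exp (h i - k j) + exp (- (h i - k j)) - 2) * (u i \<bullet> v j)\<^sup>2)"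
    by (intro sum_mono mult_right_mono square_le_two_cosh) auto
  also have "\<dots> = mexp H \<bullet> mexp (- K) + mexp (- H) \<bullet> mexp K - 2 * (mat 1 \<bullet> (mat 1 :: real^'a^'a))"
    unfolding ip[OF eigenbasis_mexp[OF u] eigenbasis_mexp[OF v']]
      ip[OF eigenbasis_mexp[OF u'] eigenbasis_mexp[OF v]]
      ip[OF eigenbasis_mat1[OF B(1)] eigenbasis_mat1[OF B(2)]]
    unfolding sum_distrib_left sum.distrib[symmetric] sum_subtractf[symmetric]
    by (intro sum.cong refl) (simp add: algebra_simps flip: exp_add)
  finally show ?thesis .
qed

lemma inner_mult_move:
  fixes A :: "real^'a::finite^'b::finite" and B :: "real^'c::finite^'b" and C :: "real^'a^'c"
  shows "A \<bullet> (B ** C) = (transpose B ** A) \<bullet> C" "A \<bullet> (B ** C) = (A ** transpose C) \<bullet> B"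
proof -
  show "A \<bullet> (B ** C) = (transpose B ** A) \<bullet> C"
    by (simp add: matrix_inner_trace matrix_transpose_mul matrix_mul_assoc)
  show "A \<bullet> (B ** C) = (A ** transpose C) \<bullet> B"
    using trace_mul_sym[of "transpose A ** B" C]
    by (simp add: matrix_inner_trace matrix_transpose_mul matrix_mul_assoc)
qed

text \<open>
Along a geodesic the traces depend only on the difference of the parameters, since
$(G e^{sX} G)(G e^{tX} G)^{-1}$ is conjugate to $e^{(s-t)X}$.
\<close>

lemma log_geodesic_step:
  fixes X G :: "real^'a::finite^'a"
  assumes X: "eigenbasis u x X" and G: "G \<in> spd"
  defines "Y \<equiv> \<lambda>t. mlog (G ** mexp (t *\<^sub>R X) ** G)"
  shows "(norm (Y s - Y t))\<^sup>2 \<le> (\<Sum>i\<in>UNIV. 2 * cosh ((s - t) * x i) - 2)"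
proof -
  define F where "F = matrix_inv G"
  have sX: "transpose X = X" using eigenbasis_symmetric[OF X] .
  note sG = spd_symmetric[OF G]
  have F: "F \<in> spd" "G ** F = mat 1" "F ** G = mat 1"
    using spd_matrix_inv[OF G] by (auto simp: F_def)
  have spdG: "G ** mexp (t *\<^sub>R X) ** G \<in> spd" for t
    using spd_congruence_invertible[OF mexp_spd spd_invertible[OF G], of "t *\<^sub>R X"] sX sG by simp
  have Y: "transpose (Y t) = Y t" "mexp (Y t) = G ** mexp (t *\<^sub>R X) ** G" for t
    unfolding Y_def using mlog_symmetric[OF spdG] mexp_mlog[OF spdG] by auto
  have Ym: "mexp (- Y t) = F ** mexp ((-t) *\<^sub>R X) ** F" for t
  proof -
    have "(F ** mexp ((-t) *\<^sub>R X) ** F) ** (G ** mexp (t *\<^sub>R X) ** G)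
       = F ** (mexp ((-t) *\<^sub>R X) ** (F ** G) ** mexp (t *\<^sub>R X)) ** G"
      by (simp add: matrix_mul_assoc)
    also have "\<dots> = mat 1"
      by (simp only: F(3) matrix_mul_rid mexp_add_commuting_scale[OF sX]) (simp add: F)
    finally have 1: "(F ** mexp ((-t) *\<^sub>R X) ** F) ** mexp (Y t) = mat 1" by (simp add: Y)
    have "F ** mexp ((-t) *\<^sub>R X) ** F = (F ** mexp ((-t) *\<^sub>R X) ** F) ** (mexp (Y t) ** mexp (- Y t))"
      by (simp only: mexp_minus_inverse[OF Y(1)] matrix_mul_rid)
    then show ?thesis by (simp only: matrix_mul_assoc 1 matrix_mul_lid)
  qed
  have sY: "transpose (mexp (Y t)) = mexp (Y t)" for t by (intro spd_symmetric mexp_spd Y)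
  have ip: "mexp (Y s) \<bullet> mexp (- Y t) = (\<Sum>i\<in>UNIV. exp ((s - t) * x i))" for s t
  proof -
    have "mexp (Y s) \<bullet> mexp (- Y t) = trace (G ** mexp (s *\<^sub>R X) ** (G ** F) ** mexp ((-t) *\<^sub>R X) ** F)"
      by (simp add: matrix_inner_trace sY) (simp add: Y Ym matrix_mul_assoc)
    also have "\<dots> = trace (G ** (mexp (s *\<^sub>R X) ** mexp ((-t) *\<^sub>R X)) ** F)"
      by (simp add: F matrix_mul_assoc)
    also have "\<dots> = trace (G ** (mexp ((s - t) *\<^sub>R X) ** F))"
      by (simp only: mexp_add_commuting_scale[OF sX]) (simp add: matrix_mul_assoc)
    also have "\<dots> = trace (mexp ((s - t) *\<^sub>R X) ** (F ** G))"
      by (subst trace_mul_sym) (simp add: matrix_mul_assoc)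
    also have "\<dots> = (\<Sum>i\<in>UNIV. exp ((s - t) * x i))"
      using eigenbasisD(1)[OF X]
      by (simp add: F trace_orthonormal_basis[OF eigenbasisD(1)[OF X]]
         eigenbasisD(2)[OF eigenbasis_mexp[OF eigenbasis_scaleR[OF X]]] orthonormal_basis_def)
    finally show ?thesis .
  qed
  have n: "mat 1 \<bullet> (mat 1 :: real^'a^'a) = (\<Sum>i\<in>(UNIV::'a set). 1)"
    unfolding matrix_inner_orthonormal_basis[OF eigenbasisD(1)[OF X]]
    by (simp add: orthonormal_basisD[OF eigenbasisD(1)[OF X]])
  have ip2: "mexp (- Y s) \<bullet> mexp (Y t) = (\<Sum>i\<in>UNIV. exp ((t - s) * x i))"
    using ip[of t s] by (simp add: inner_commute)
  have "exp ((s - t) * x i) + exp ((t - s) * x i) - 2 = 2 * cosh ((s - t) * x i) - 2" for i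
  proof -
    have "(t - s) * x i = - ((s - t) * x i)" by (simp add: algebra_simps)
    then show ?thesis by (simp add: cosh_field_def)
  qed
  then have "(\<Sum>i\<in>UNIV. exp ((s - t) * x i)) + (\<Sum>i\<in>UNIV. exp ((t - s) * x i)) - 2 * (\<Sum>i\<in>(UNIV::'a set). 1)
      = (\<Sum>i\<in>UNIV. 2 * cosh ((s - t) * x i) - 2)"
    unfolding sum_distrib_left sum.distrib[symmetric] sum_subtractf[symmetric] by simp
  then show ?thesis
    using log_difference_bound[OF Y(1)[of s] Y(1)[of t]] unfolding ip ip2 n by simp
qed

lemma cosh_limit: "(\<lambda>N. (real N)\<^sup>2 * (2 * cosh (x / real N) - 2)) \<longlonglongrightarrow> x\<^sup>2"
proof (cases "x = 0")
  case False
  have "((\<lambda>h::real. (2 * cosh h - 2) / h\<^sup>2) \<longlongrightarrow> 1) (at 0)"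
    unfolding cosh_field_def by real_asymp
  moreover have "filterlim (\<lambda>N. x / real N) (at 0) sequentially"
    unfolding filterlim_at using False
    by (auto intro!: tendsto_divide_0[OF tendsto_const] filterlim_real_at_infinity_sequentially
        eventually_mono[OF eventually_gt_at_top[of 0]])
  ultimately have "(\<lambda>N. x\<^sup>2 * ((2 * cosh (x / real N) - 2) / (x / real N)\<^sup>2)) \<longlonglongrightarrow> x\<^sup>2 * 1"
    by (intro tendsto_mult tendsto_const) (rule filterlim_compose)
  moreover have "x\<^sup>2 * (c / (x / n)\<^sup>2) = n\<^sup>2 * c" for c n :: real
    using False by (cases "n = 0") (simp_all add: power2_eq_square)
  ultimately show ?thesis by simp
qed auto

text \<open>
The one-step bound for logarithms agrees with the distance to leading order. Subdividing the
geodesic into $N$ equal pieces removes the error in the limit.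
\<close>

theorem exponential_metric_increasing:
  fixes H K :: "real^'a::finite^'a"
  assumes H: "transpose H = H" and K: "transpose K = K"
  shows "norm (H - K) \<le> d_AI (mexp H) (mexp K)"
proof -
  define G where "G = msqrt (mexp H)"
  define X where "X = mlog (matrix_inv G ** mexp K ** matrix_inv G)"
  note X = geodesic_to[OF mexp_spd[OF H] mexp_spd[OF K], folded G_def, folded X_def]
  note G = msqrt_spd_square[OF mexp_spd[OF H], folded G_def]
  obtain u x where u: "eigenbasis u x X" using spectral_theorem[OF X(1)] .
  \<comment> \<open>The logarithms of the points of the geodesic from the first matrix to the second.\<close>
  define Y where "Y t = mlog (G ** mexp (t *\<^sub>R X) ** G)" for t
  have Y0: "Y 0 = H" using G(2) by (simp add: Y_def mlog_mexp H)
  have Y1: "Y 1 = K" using X(2) by (simp add: Y_def mlog_mexp K)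
  have "norm (H - K) \<le> sqrt (\<Sum>i\<in>UNIV. (real N)\<^sup>2 * (2 * cosh (x i / real N) - 2))" if N: "N > 0" for N :: nat
  proof -
    have "norm (H - K) = norm (\<Sum>k<N. Y (real (Suc k) / N) - Y (real k / N))"
      using N by (subst sum_lessThan_telescope) (simp add: Y0 Y1 norm_minus_commute)
    also have "\<dots> \<le> (\<Sum>k<N. norm (Y (real (Suc k) / N) - Y (real k / N)))"
      by (rule norm_sum)
    also have "\<dots> \<le> (\<Sum>k<N. sqrt (\<Sum>i\<in>UNIV. 2 * cosh (x i / N) - 2))"
    proof (intro sum_mono real_le_rsqrt)
      fix k
      have "real (Suc k) / N - real k / N = 1 / N" by (simp add: add_divide_distrib)
      then show "(norm (Y (real (Suc k) / N) - Y (real k / N)))\<^sup>2 \<le> (\<Sum>i\<in>UNIV. 2 * cosh (x i / N) - 2)"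
        using log_geodesic_step[OF u G(1), of "real (Suc k) / N" "real k / N"] by (simp add: Y_def)
    qed
    also have "\<dots> = sqrt (\<Sum>i\<in>UNIV. (real N)\<^sup>2 * (2 * cosh (x i / real N) - 2))"
      by (simp add: real_sqrt_mult flip: sum_distrib_left)
    finally show ?thesis .
  qed
  then have ev: "eventually (\<lambda>N. norm (H - K) \<le> sqrt (\<Sum>i\<in>UNIV. (real N)\<^sup>2 * (2 * cosh (x i / real N) - 2))) sequentially"
    by (intro eventually_mono[OF eventually_gt_at_top[of 0]]) auto
  have "(\<lambda>N. sqrt (\<Sum>i\<in>UNIV. (real N)\<^sup>2 * (2 * cosh (x i / real N) - 2))) \<longlonglongrightarrow> sqrt (\<Sum>i\<in>UNIV. (x i)\<^sup>2)"
    by (intro tendsto_real_sqrt tendsto_sum cosh_limit)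
  from tendsto_lowerbound[OF this ev] have "norm (H - K) \<le> sqrt ((norm X)\<^sup>2)"
    by (simp add: norm2_eigenbasis[OF u])
  then show ?thesis using X(3) by simp
qed

section \<open>The comparison function\<close>

lemma psi_minus [simp]: "psi (- s) = psi s"
  by (simp add: psi_def)

lemma psi_abs: "psi \<bar>s\<bar> = psi s"
  by (cases "s \<ge> 0") auto

text \<open>
This is the sign of the derivative of $\psi$.
\<close>

lemma sinh_cosh_ge: "s \<ge> 0 \<Longrightarrow> s \<le> sinh s * cosh (s::real)"
proof -
  assume s: "s \<ge> 0"
  have "2 * s \<le> sinh (2 * s)"
    using real_le_x_sinh[of "2 * s"] s by (simp add: sinh_field_def exp_minus)
  then show ?thesis by (simp add: sinh_double)
qed

lemma psi_deriv:
  assumes "s > 0"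
  shows "(psi has_real_derivative ((sinh s * cosh s - s) / (sinh s)\<^sup>2)) (at s)"
proof -
  have "((\<lambda>s. s * cosh s / sinh s) has_real_derivative ((sinh s * cosh s - s) / (sinh s)\<^sup>2)) (at s)"
    using assms
    by (auto intro!: derivative_eq_intros simp: field_simps power2_eq_square)
       (use cosh_square_eq[of s] in \<open>simp add: algebra_simps power2_eq_square\<close>)
  moreover have "eventually (\<lambda>s. psi s = s * cosh s / sinh s) (nhds s)"
    using eventually_nhds_in_open[of "{0<..}" s] assms by (auto elim!: eventually_mono simp: psi_def)
  ultimately show ?thesis by (subst DERIV_cong_ev) auto
qed

text \<open>
Continuity at $0$ is needed too: a run that starts with radius zero evaluates $\psi$ there.
\<close>

lemma isCont_psi: "isCont psi s"
proof (cases "s = 0")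
  case True
  have "((\<lambda>s::real. s * ((exp s + exp (-s))/2) / ((exp s - exp (-s))/2)) \<longlongrightarrow> 1) (at 0)"
    by real_asymp
  then have "(psi \<longlongrightarrow> 1) (at 0)"
    by (rule Lim_transform_eventually)
       (auto simp: psi_def sinh_field_def cosh_field_def eventually_at_filter)
  then show ?thesis using True by (simp add: isCont_def psi_def)
next
  case False
  have *: "isCont psi s" if "s > 0" for s using psi_deriv[OF that] by (rule DERIV_isCont)
  show ?thesis
  proof (cases "s > 0")
    case False
    with \<open>s \<noteq> 0\<close> have "isCont (\<lambda>x. psi (- x)) s"
      by (intro isCont_o2[OF _ *] continuous_intros) auto
    then show ?thesis by simp
  qed (rule *)
qed

lemma psi_mono:
  assumes "0 \<le> s" "s \<le> t" shows "psi s \<le> psi t"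
proof (rule DERIV_nonneg_imp_increasing_open[OF assms(2)])
  fix x assume "s < x" "x < t"
  then have "x > 0" using assms by simp
  then show "\<exists>y. (psi has_real_derivative y) (at x) \<and> 0 \<le> y"
    using psi_deriv[of x] sinh_cosh_ge[of x] by (intro exI conjI) auto
qed (simp add: continuous_at_imp_continuous_on isCont_psi)

lemma psi_ge_1: "1 \<le> psi s"
  using psi_mono[of 0 "\<bar>s\<bar>"] by (simp add: psi_abs) (simp add: psi_def)

section \<open>Moving a logarithm by a congruence\<close>

definition msinh :: "real^'a::finite^'a \<Rightarrow> real^'a^'a" where
  "msinh X = (1/2) *\<^sub>R (mexp X - mexp (- X))"

definition mcosh :: "real^'a::finite^'a \<Rightarrow> real^'a^'a" where
  "mcosh X = (1/2) *\<^sub>R (mexp X + mexp (- X))"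

lemma eigenbasis_minus: "eigenbasis u l X \<Longrightarrow> eigenbasis u (\<lambda>i. - l i) (- X)"
  using eigenbasis_scaleR[of u l X "-1"] by simp

lemma eigenbasis_msinh: "eigenbasis u l X \<Longrightarrow> eigenbasis u (\<lambda>i. sinh (l i)) (msinh X)"
  using eigenbasis_scaleR[of u "\<lambda>i. exp (l i) - exp (- l i)" "mexp X - mexp (- X)" "1/2"]
    eigenbasis_diff[OF eigenbasis_mexp eigenbasis_mexp[OF eigenbasis_minus], of u l X l X]
  by (simp add: msinh_def sinh_field_def)

lemma eigenbasis_mcosh: "eigenbasis u l X \<Longrightarrow> eigenbasis u (\<lambda>i. cosh (l i)) (mcosh X)"
  using eigenbasis_scaleR[of u "\<lambda>i. exp (l i) + exp (- l i)" "mexp X + mexp (- X)" "1/2"]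
    eigenbasis_add[OF eigenbasis_mexp eigenbasis_mexp[OF eigenbasis_minus], of u l X l X]
  by (simp add: mcosh_def cosh_field_def)

text \<open>
The eigenvalues of $\cosh X$ are at least $1$.
\<close>

lemma matrix_vector_mult_mcosh_norm_ge:
  assumes "transpose X = X" shows "norm v \<le> norm (mcosh X *v v)"
proof -
  obtain u l where u: "eigenbasis u l X" using spectral_theorem[OF assms] .
  note B = eigenbasisD(1)[OF u]
  have "v \<bullet> v = (\<Sum>i\<in>UNIV. 1 * (u i \<bullet> v)\<^sup>2)"
    by (subst inner_orthonormal_basis[OF B]) (simp add: power2_eq_square)
  also have "\<dots> \<le> (\<Sum>i\<in>UNIV. (cosh (l i))\<^sup>2 * (u i \<bullet> v)\<^sup>2)"
    by (intro sum_mono mult_right_mono) (auto simp: cosh_real_ge_1)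
  also have "\<dots> = (mcosh X *v v) \<bullet> (mcosh X *v v)"
    by (subst inner_orthonormal_basis[OF B])
       (simp add: eigenbasis_inner_left[OF eigenbasis_mcosh[OF u]] power2_eq_square mult_ac)
  finally show ?thesis by (simp add: norm_le)
qed

text \<open>
Since $e^{-X} e^{V'} = e^{V} e^{X}$, the mixed entries of $e^{X}$ and of $e^{-X}$ differ by
the factor $e^{w'_j - w_i}$, which fixes the ratio of the entries of $\sinh X$ and $\cosh X$ to be
$\tanh((w'_j - w_i)/2)$.
\<close>

lemma displacement_components:
  fixes V V' X :: "real^'a::finite^'a"
  assumes V: "eigenbasis u w V" and V': "eigenbasis v w' V'" and X: "transpose X = X"
    and step: "mexp V' = mexp X ** mexp V ** mexp X"
  obtains q where "u i \<bullet> (msinh X *v v j) = (exp (w' j - w i) - 1) * q"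
    and "u i \<bullet> (mcosh X *v v j) = (exp (w' j - w i) + 1) * q"
proof -
  define p where "p = u i \<bullet> (mexp X *v v j)"
  define q where "q = u i \<bullet> (mexp (- X) *v v j)"
  have "mexp (- X) ** mexp V' = (mexp (- X) ** mexp X) ** (mexp V ** mexp X)"
    by (simp only: step matrix_mul_assoc)
  also have "\<dots> = mexp V ** mexp X" by (simp only: mexp_minus_inverse[OF X] matrix_mul_lid)
  finally have "u i \<bullet> (mexp (- X) *v (mexp V' *v v j)) = u i \<bullet> (mexp V *v (mexp X *v v j))"
    by (simp only: matrix_vector_mul_assoc)
  then have "exp (w' j) * q = exp (w i) * p"
    by (simp add: p_def q_def eigenbasis_inner_left[OF eigenbasis_mexp[OF V]]
       eigenbasisD(2)[OF eigenbasis_mexp[OF V']] matrix_vector_mult_scaleR)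
  then have p: "p = exp (w' j - w i) * q" by (simp add: exp_diff field_simps)
  show ?thesis
  proof
    show "u i \<bullet> (msinh X *v v j) = (exp (w' j - w i) - 1) * (q / 2)"
      using p unfolding msinh_def p_def q_def
      by (simp add: scaleR_matrix_vector_assoc[symmetric] matrix_vector_mult_diff_rdistrib inner_diff_right algebra_simps)
    show "u i \<bullet> (mcosh X *v v j) = (exp (w' j - w i) + 1) * (q / 2)"
      using p unfolding mcosh_def p_def q_def
      by (simp add: scaleR_matrix_vector_assoc[symmetric] matrix_vector_mult_add_rdistrib inner_add_right algebra_simps)
  qed
qed

lemma exp_minus_one_half: "exp \<delta> - 1 = exp (\<delta> / 2) * (2 * sinh (\<delta> / 2))"
  and exp_plus_one_half: "exp \<delta> + 1 = exp (\<delta> / 2) * (2 * cosh (\<delta> / 2))" for \<delta> :: real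
proof -
  have e: "exp \<delta> = exp (\<delta>/2) * exp (\<delta>/2)" by (simp flip: exp_add)
  show "exp \<delta> - 1 = exp (\<delta> / 2) * (2 * sinh (\<delta> / 2))"
    unfolding e by (simp add: sinh_field_def algebra_simps exp_minus)
  show "exp \<delta> + 1 = exp (\<delta> / 2) * (2 * cosh (\<delta> / 2))"
    unfolding e by (simp add: cosh_field_def algebra_simps exp_minus)
qed

text \<open>
That is, $\psi(\delta/2) = \frac{\delta}{2} \coth \frac{\delta}{2}$, cleared of denominators so
that it also holds at $\delta = 0$.
\<close>

lemma psi_half_exp: "(exp \<delta> - 1) * psi (\<delta> / 2) = \<delta> / 2 * (exp \<delta> + 1)" for \<delta> :: real
  by (cases "\<delta> = 0") (simp_all add: exp_minus_one_half exp_plus_one_half psi_def)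

text \<open>
The left side equals $2\,\mathrm{tr}\,((V' - V) \cosh X \sinh X)$. Expanded in the two eigenbases it
pairs the difference $w'_j - w_i$ with the entries of $\cosh X$ and of $\sinh X$; their fixed ratio
turns the product into $\psi$ times a square. It replaces the second derivative of the
squared distance, and no limit is involved.
\<close>

theorem log_displacement_identity:
  fixes V V' X :: "real^'a::finite^'a"
  assumes V: "eigenbasis u w V" and V': "eigenbasis v w' V'" and X: "transpose X = X"
    and step: "mexp V' = mexp X ** mexp V ** mexp X"
  shows "(V' - V) \<bullet> msinh (2 *\<^sub>R X) =
    4 * (\<Sum>j\<in>UNIV. \<Sum>i\<in>UNIV. psi ((w' j - w i) / 2) * (u i \<bullet> (msinh X *v v j))\<^sup>2)"
proof -
  note B = eigenbasisD(1)[OF V] eigenbasisD(1)[OF V']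
  obtain e x where e: "eigenbasis e x X" using spectral_theorem[OF X] .
  let ?s = "msinh X" and ?c = "mcosh X"
  have "eigenbasis e (\<lambda>i. 1/2 * sinh (2 * x i)) ((1/2) *\<^sub>R msinh (2 *\<^sub>R X))"
    by (intro eigenbasis_scaleR eigenbasis_msinh e)
  moreover have "(\<lambda>i. 1/2 * sinh (2 * x i)) = (\<lambda>i. cosh (x i) * sinh (x i))"
    by (simp add: sinh_double fun_eq_iff)
  ultimately have e2: "eigenbasis e (\<lambda>i. cosh (x i) * sinh (x i)) ((1/2) *\<^sub>R msinh (2 *\<^sub>R X))"
    by metis
  have cs: "?c ** ?s = (1/2) *\<^sub>R msinh (2 *\<^sub>R X)" "?s ** ?c = (1/2) *\<^sub>R msinh (2 *\<^sub>R X)"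
    using eigenbasis_mult[OF eigenbasis_mcosh[OF e] eigenbasis_msinh[OF e]]
      eigenbasis_mult[OF eigenbasis_msinh[OF e] eigenbasis_mcosh[OF e]]
    by (auto intro!: eigenbasis_unique[OF _ e2] simp: mult.commute)
  have ts: "transpose ?s = ?s" using eigenbasis_symmetric[OF eigenbasis_msinh[OF e]] .
  have 1: "?c \<bullet> (?s ** V') = (1/2) *\<^sub>R msinh (2 *\<^sub>R X) \<bullet> V'"
    by (simp only: inner_mult_move ts cs)
  have 2: "?c \<bullet> (V ** ?s) = (1/2) *\<^sub>R msinh (2 *\<^sub>R X) \<bullet> V"
    unfolding inner_mult_move(2)[of ?c V ?s] by (simp only: ts cs)
  have "(V' - V) \<bullet> msinh (2 *\<^sub>R X) = 2 * (?c \<bullet> (?s ** V') - ?c \<bullet> (V ** ?s))"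
    unfolding 1 2 by (simp add: inner_diff_left inner_commute)
  also have "\<dots> = 2 * (\<Sum>j\<in>UNIV. \<Sum>i\<in>UNIV. (w' j - w i) * (u i \<bullet> (?c *v v j)) * (u i \<bullet> (?s *v v j)))"
    unfolding matrix_inner_two_bases[OF B] sum_subtractf[symmetric]
    by (simp add: eigenbasis_inner_left[OF V] eigenbasisD(2)[OF V'] matrix_vector_mult_scaleR
        matrix_vector_mul_assoc[symmetric] algebra_simps)
  also have "\<dots> = 2 * (\<Sum>j\<in>UNIV. \<Sum>i\<in>UNIV. 2 * (psi ((w' j - w i) / 2) * (u i \<bullet> (?s *v v j))\<^sup>2))"
  proof (intro arg_cong[where f = "\<lambda>x. 2 * x"] sum.cong refl)
    fix i j
    obtain q where q: "u i \<bullet> (?s *v v j) = (exp (w' j - w i) - 1) * q"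
      "u i \<bullet> (?c *v v j) = (exp (w' j - w i) + 1) * q"
      by (rule displacement_components[OF V V' X step])
    have "2 * (psi ((w' j - w i) / 2) * (u i \<bullet> (?s *v v j))\<^sup>2)
      = 2 * ((exp (w' j - w i) - 1) * psi ((w' j - w i) / 2)) * ((exp (w' j - w i) - 1) * q * q)"
      unfolding q by (simp add: power2_eq_square)
    also have "\<dots> = (w' j - w i) * (u i \<bullet> (?c *v v j)) * (u i \<bullet> (?s *v v j))"
      unfolding psi_half_exp q by simp
    finally show "(w' j - w i) * (u i \<bullet> (?c *v v j)) * (u i \<bullet> (?s *v v j)) = 2 * (psi ((w' j - w i) / 2) * (u i \<bullet> (?s *v v j))\<^sup>2)" ..
  qed
  finally show ?thesis by (simp flip: sum_distrib_left)
qed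

text \<open>
If every $w_i$ were farther than $2h$ from $w'_j$, then $\|\sinh(X) v_j\|$ would be at least
$\tanh(h)\,\|\cosh(X) v_j\| \ge \tanh h$.
\<close>

lemma nearby_eigenvalue:
  fixes V V' X :: "real^'a::finite^'a"
  assumes V: "eigenbasis u w V" and V': "eigenbasis v w' V'" and X: "transpose X = X"
    and step: "mexp V' = mexp X ** mexp V ** mexp X"
    and h: "h > 0" "norm (msinh X) < tanh h"
  shows "\<exists>i. \<bar>w' j - w i\<bar> / 2 \<le> h"
proof (rule ccontr)
  assume "\<nexists>i. \<bar>w' j - w i\<bar> / 2 \<le> h"
  then have far: "h \<le> \<bar>w' j - w i\<bar> / 2" for i by (meson linear)
  note B = eigenbasisD(1)[OF V]
  let ?s = "msinh X" and ?c = "mcosh X"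
  have nv: "norm (v j) = 1" using orthonormal_basisD[OF eigenbasisD(1)[OF V'], of j j] by (simp add: norm_eq_1)
  have comp: "(tanh h)\<^sup>2 * (u i \<bullet> (?c *v v j))\<^sup>2 \<le> (u i \<bullet> (?s *v v j))\<^sup>2" for i
  proof -
    define \<delta> where "\<delta> = w' j - w i"
    obtain q where q: "u i \<bullet> (?s *v v j) = (exp \<delta> - 1) * q"
      "u i \<bullet> (?c *v v j) = (exp \<delta> + 1) * q"
      unfolding \<delta>_def by (rule displacement_components[OF V V' X step])
    have "exp \<delta> - 1 = tanh (\<delta> / 2) * (exp \<delta> + 1)"
      by (simp add: exp_minus_one_half exp_plus_one_half tanh_def)
    then have eq: "u i \<bullet> (?s *v v j) = tanh (\<delta> / 2) * (u i \<bullet> (?c *v v j))"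
      unfolding q by simp
    have "tanh h \<le> tanh (\<bar>\<delta>\<bar> / 2)" using far[of i] by (simp add: \<delta>_def)
    also have "\<dots> = \<bar>tanh (\<delta> / 2)\<bar>" by (cases "\<delta> \<ge> 0") (auto simp: abs_if)
    finally have "(tanh h)\<^sup>2 \<le> (tanh (\<delta> / 2))\<^sup>2" using h(1) by (simp add: abs_le_square_iff[symmetric])
    then show ?thesis unfolding eq power_mult_distrib by (intro mult_right_mono) auto
  qed
  have "(tanh h)\<^sup>2 * 1 \<le> (tanh h)\<^sup>2 * (norm (?c *v v j))\<^sup>2"
    using matrix_vector_mult_mcosh_norm_ge[OF X, of "v j"] nv by (intro mult_left_mono) auto
  also have "\<dots> = (\<Sum>i\<in>UNIV. (tanh h)\<^sup>2 * (u i \<bullet> (?c *v v j))\<^sup>2)"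
    unfolding power2_norm_eq_inner by (subst inner_orthonormal_basis[OF B]) (simp add: sum_distrib_left power2_eq_square)
  also have "\<dots> \<le> (\<Sum>i\<in>UNIV. (u i \<bullet> (?s *v v j))\<^sup>2)" by (intro sum_mono comp)
  also have "\<dots> \<le> (norm ?s)\<^sup>2"
    unfolding norm2_matrix_two_bases[OF B eigenbasisD(1)[OF V']]
    by (rule member_le_sum[where i = j]) (auto intro!: sum_nonneg)
  also have "\<dots> < (tanh h)\<^sup>2" using h by (intro power_strict_mono) auto
  finally show False by simp
qed

text \<open>
Two different indices contribute $w_l^2 + w_i^2$ to $\|V\|^2$. This is the source of the factor
$\sqrt 2$ in the smoothness constant.
\<close>

lemma eigenvalue_gap:
  assumes "eigenbasis u w V" shows "\<bar>w l - w i\<bar> \<le> sqrt 2 * norm V"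
proof (cases "l = i")
  case False
  have "(w l - w i)\<^sup>2 \<le> 2 * ((w l)\<^sup>2 + (w i)\<^sup>2)"
    using sum_squares_ge_zero[of "w l + w i" 0] by (simp add: power2_eq_square algebra_simps)
  also have "(w l)\<^sup>2 + (w i)\<^sup>2 = (\<Sum>k\<in>{l, i}. (w k)\<^sup>2)" using False by simp
  also have "\<dots> \<le> (norm V)\<^sup>2" unfolding norm2_eigenbasis[OF assms] by (intro sum_mono2) auto
  finally have "\<bar>w l - w i\<bar> \<le> sqrt (2 * (norm V)\<^sup>2)" by (intro real_le_rsqrt) simp
  then show ?thesis by (simp add: real_sqrt_mult)
qed simp

text \<open>
The identity mixes eigenvalues of $V$ and of $V'$. Replacing $w'_j$ by a nearby eigenvalue of
$V$ costs at most $h$ in the argument of $\psi$.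
\<close>

lemma log_displacement_upper:
  fixes V V' X :: "real^'a::finite^'a"
  assumes V: "transpose V = V" and V': "transpose V' = V'" and X: "transpose X = X"
    and step: "mexp V' = mexp X ** mexp V ** mexp X"
    and h: "h > 0" "norm (msinh X) < tanh h" and D: "norm V \<le> D"
  shows "(V' - V) \<bullet> msinh (2 *\<^sub>R X) \<le> 4 * (psi (D / sqrt 2 + h) * (norm (msinh X))\<^sup>2)"
proof -
  obtain u w where u: "eigenbasis u w V" using spectral_theorem[OF V] .
  obtain v w' where v: "eigenbasis v w' V'" using spectral_theorem[OF V'] .
  have *: "psi ((w' j - w i) / 2) \<le> psi (D / sqrt 2 + h)" for i j
  proof -
    obtain l where "\<bar>w' j - w l\<bar> / 2 \<le> h" using nearby_eigenvalue[OF u v X step h] by blast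
    moreover have "\<bar>w l - w i\<bar> / 2 \<le> D / sqrt 2"
    proof -
      have "\<bar>w l - w i\<bar> \<le> sqrt 2 * D"
        using order_trans[OF eigenvalue_gap[OF u, of l i] mult_left_mono[OF D, of "sqrt 2"]] by simp
      moreover have "sqrt 2 * D / 2 = D / sqrt 2" by (simp add: field_simps)
      ultimately show ?thesis by (metis divide_right_mono zero_le_numeral)
    qed
    moreover have "\<bar>(w' j - w i) / 2\<bar> \<le> \<bar>w' j - w l\<bar> / 2 + \<bar>w l - w i\<bar> / 2"
      by simp
    ultimately have "\<bar>(w' j - w i) / 2\<bar> \<le> D / sqrt 2 + h" by linarith
    then show ?thesis using psi_mono[OF abs_ge_zero] by (simp only: psi_abs)
  qed
  show ?thesis
    unfolding log_displacement_identity[OF u v X step]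
      norm2_matrix_two_bases[OF eigenbasisD(1)[OF u] eigenbasisD(1)[OF v]] sum_distrib_left
    by (intro sum_mono mult_left_mono mult_right_mono *) auto
qed

section \<open>Squared distance along a geodesic through the identity\<close>

lemma sinh_limit: "(\<lambda>N. real N * sinh (x / real N)) \<longlonglongrightarrow> x"
proof (cases "x = 0")
  case False
  have "((\<lambda>h::real. sinh h / h) \<longlongrightarrow> 1) (at 0)"
    unfolding sinh_field_def by real_asymp
  moreover have "filterlim (\<lambda>N. x / real N) (at 0) sequentially"
    unfolding filterlim_at using False
    by (auto intro!: tendsto_divide_0[OF tendsto_const] filterlim_real_at_infinity_sequentially
        eventually_mono[OF eventually_gt_at_top[of 0]])
  ultimately have "(\<lambda>N. x * (sinh (x / real N) / (x / real N))) \<longlonglongrightarrow> x * 1"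
    by (intro tendsto_mult tendsto_const) (rule filterlim_compose)
  moreover have "x * (c / (x / n)) = n * c" for c n :: real
    using False by (cases "n = 0") simp_all
  ultimately show ?thesis by simp
qed auto

lemma msinh_limit:
  assumes "transpose X = X"
  shows "(\<lambda>N. real N *\<^sub>R msinh ((c / real N) *\<^sub>R X)) \<longlonglongrightarrow> c *\<^sub>R X"
proof -
  obtain u x where u: "eigenbasis u x X" using spectral_theorem[OF assms] .
  have 1: "real N *\<^sub>R msinh ((c / real N) *\<^sub>R X) = spectral u (\<lambda>i. real N * sinh ((c * x i) / real N))" for N
    using eigenbasis_eq_spectral[OF eigenbasis_scaleR[OF eigenbasis_msinh[OF eigenbasis_scaleR[OF u]]], of "real N" "c / real N"]
    by simp
  have "(\<lambda>N. spectral u (\<lambda>i. real N * sinh ((c * x i) / real N))) \<longlonglongrightarrow> spectral u (\<lambda>i. c * x i)"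
    unfolding spectral_def by (intro tendsto_sum tendsto_scaleR tendsto_const sinh_limit)
  then show ?thesis unfolding 1 using eigenbasis_eq_spectral[OF eigenbasis_scaleR[OF u, of c]] by simp
qed

lemma msinh_limit_zero:
  assumes "transpose X = X"
  shows "(\<lambda>N. msinh ((c / real N) *\<^sub>R X)) \<longlonglongrightarrow> 0"
proof -
  have "(\<lambda>N. (1 / real N) *\<^sub>R (real N *\<^sub>R msinh ((c / real N) *\<^sub>R X))) \<longlonglongrightarrow> 0 *\<^sub>R (c *\<^sub>R X)"
    by (intro tendsto_scaleR msinh_limit assms lim_1_over_n)
  then have "(\<lambda>N. (1 / real N) *\<^sub>R (real N *\<^sub>R msinh ((c / real N) *\<^sub>R X))) \<longlonglongrightarrow> 0"
    by simp
  then show ?thesis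
  proof (rule Lim_transform_eventually)
    show "\<forall>\<^sub>F N in sequentially. (1 / real N) *\<^sub>R (real N *\<^sub>R msinh ((c / real N) *\<^sub>R X)) = msinh ((c / real N) *\<^sub>R X)"
      using eventually_gt_at_top[of 0] by eventually_elim simp
  qed
qed

text \<open>
The geodesic through the identity with velocity $-X$, seen from $R$. The matrix \<open>log_at s\<close>
is the logarithm of $R$ relative to the point at parameter $s$, so its norm is the distance,
\<open>energy\<close> is the half squared distance, and \<open>slope\<close> is the derivative of \<open>energy\<close>.
\<close>

locale spd_ray =
  fixes R X :: "real^'a::finite^'a"
  assumes R: "R \<in> spd" and X: "transpose X = X"
begin

definition log_at :: "real \<Rightarrow> real^'a^'a" where
  "log_at s = mlog (mexp ((s / 2) *\<^sub>R X) ** R ** mexp ((s / 2) *\<^sub>R X))"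

lemma log_at_symmetric: "transpose (log_at s) = log_at s"
  and mexp_log_at: "mexp (log_at s) = mexp ((s / 2) *\<^sub>R X) ** R ** mexp ((s / 2) *\<^sub>R X)"
  using mlog_symmetric mexp_mlog mexp_congruence_spd[OF _ R, of "(s / 2) *\<^sub>R X"] X by (auto simp: log_at_def)

lemma log_at_step: "mexp (log_at t) = mexp (((t - s) / 2) *\<^sub>R X) ** mexp (log_at s) ** mexp (((t - s) / 2) *\<^sub>R X)"
proof -
  have "(t - s) / 2 + s / 2 = t / 2" by (simp add: diff_divide_distrib)
  then show ?thesis by (simp only: mexp_log_at mexp_congruence_path[OF X])
qed

lemma norm_log_at: "norm (log_at s) = d_AI (mexp ((- s) *\<^sub>R X)) R"
  using d_AI_mexp[of "(- s) *\<^sub>R X" R] R X by (simp add: log_at_def transpose_minus)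

text \<open>
Recentring at the point with parameter $s$ turns both matrices into exponentials, where
\<open>exponential_metric_increasing\<close> compares their distance with a Euclidean norm.
\<close>

lemma norm_log_at_ge: "norm (log_at s + (t - s) *\<^sub>R X) \<le> norm (log_at t)"
proof -
  have "norm (log_at s + (t - s) *\<^sub>R X) = norm ((- (t - s)) *\<^sub>R X - log_at s)"
    using norm_minus_cancel[of "log_at s + (t - s) *\<^sub>R X"] by (simp add: algebra_simps)
  also have "\<dots> \<le> d_AI (mexp ((- (t - s)) *\<^sub>R X)) (mexp (log_at s))"
    by (intro exponential_metric_increasing log_at_symmetric) (simp add: X)
  also have "\<dots> = norm (mlog (mexp (log_at t)))"
  proof -
    have "(- 1 / 2) *\<^sub>R (- (t - s)) *\<^sub>R X = ((t - s) / 2) *\<^sub>R X"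
      unfolding scaleR_scaleR by (rule arg_cong[where f = "\<lambda>c. c *\<^sub>R X"]) (simp add: field_simps)
    moreover have "transpose ((- (t - s)) *\<^sub>R X) = (- (t - s)) *\<^sub>R X" by (simp only: transpose_scaleR X)
    ultimately show ?thesis
      using d_AI_mexp[of "(- (t - s)) *\<^sub>R X" "mexp (log_at s)"] mexp_spd[OF log_at_symmetric[of s]]
      by (simp only: log_at_step[of t s])
  qed
  finally show ?thesis by (simp add: mlog_mexp log_at_symmetric)
qed

text \<open>
Each of the $N$ steps is a congruence by the same matrix, so the left sides of the displacement
bound are inner products with one fixed matrix, and their sum telescopes.
\<close>

lemma slope_upper_step:
  assumes st: "s \<le> t" and D: "\<And>r. s \<le> r \<Longrightarrow> r \<le> t \<Longrightarrow> norm (log_at r) \<le> D" and h: "h > 0"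
    and N: "N > 0" and small: "norm (msinh (((t - s) / 2 / real N) *\<^sub>R X)) < tanh h"
  shows "(log_at t - log_at s) \<bullet> (real N *\<^sub>R msinh (((t - s) / real N) *\<^sub>R X))
    \<le> 4 * (psi (D / sqrt 2 + h) * (norm (real N *\<^sub>R msinh (((t - s) / 2 / real N) *\<^sub>R X)))\<^sup>2)"
proof -
  define Z where "Z = ((t - s) / 2 / real N) *\<^sub>R X"
  define r where "r k = s + real k * ((t - s) / real N)" for k
  have rN: "r N = t" "r 0 = s" using N by (auto simp: r_def)
  have Z: "transpose Z = Z" using X by (simp add: Z_def)
  have Z2: "((t - s) / real N) *\<^sub>R X = 2 *\<^sub>R Z"
  proof -
    have "x / real N = 2 * (x / 2 / real N)" for x by simp
    then show ?thesis unfolding Z_def scaleR_scaleR by metis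
  qed
  have step: "(log_at (r (Suc k)) - log_at (r k)) \<bullet> msinh (2 *\<^sub>R Z) \<le> 4 * (psi (D / sqrt 2 + h) * (norm (msinh Z))\<^sup>2)"
    if k: "k < N" for k
  proof (rule log_displacement_upper[OF log_at_symmetric log_at_symmetric Z])
    have "r (Suc k) - r k = (t - s) / real N" by (simp add: r_def distrib_right add_divide_distrib)
    then have e: "(r (Suc k) - r k) / 2 = (t - s) / 2 / real N" by simp
    show "mexp (log_at (r (Suc k))) = mexp Z ** mexp (log_at (r k)) ** mexp Z"
      using log_at_step[of "r (Suc k)" "r k", unfolded e] unfolding Z_def .
    have "real k * ((t - s) / real N) \<le> real N * ((t - s) / real N)"
      using k st by (intro mult_right_mono) auto
    then have "r k \<le> t" using N by (simp add: r_def)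
    moreover have "s \<le> r k" using st by (simp add: r_def)
    ultimately show "norm (log_at (r k)) \<le> D" using D by simp
  qed (use h small in \<open>simp_all add: Z_def\<close>)
  have "(log_at t - log_at s) \<bullet> msinh (2 *\<^sub>R Z) = (\<Sum>k<N. (log_at (r (Suc k)) - log_at (r k))) \<bullet> msinh (2 *\<^sub>R Z)"
    by (subst sum_lessThan_telescope) (simp add: rN)
  also have "\<dots> = (\<Sum>k<N. (log_at (r (Suc k)) - log_at (r k)) \<bullet> msinh (2 *\<^sub>R Z))"
    by (rule inner_sum_left)
  also have "\<dots> \<le> (\<Sum>k<N. 4 * (psi (D / sqrt 2 + h) * (norm (msinh Z))\<^sup>2))"
    by (intro sum_mono step) auto
  finally have "(log_at t - log_at s) \<bullet> msinh (2 *\<^sub>R Z) \<le> real N * (4 * (psi (D / sqrt 2 + h) * (norm (msinh Z))\<^sup>2))"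
    by simp
  from mult_left_mono[OF this, of "real N"] show ?thesis
    unfolding Z2 Z_def[symmetric] by (simp add: power_mult_distrib power2_eq_square mult_ac)
qed

text \<open>
As $N$ grows, $N \sinh(cX/N)$ tends to $cX$, and the slack $h$ may then be sent to zero by
continuity of $\psi$.
\<close>

lemma slope_upper:
  assumes st: "s \<le> t" and D: "\<And>r. s \<le> r \<Longrightarrow> r \<le> t \<Longrightarrow> norm (log_at r) \<le> D"
  shows "(log_at t - log_at s) \<bullet> X \<le> (t - s) * (psi (D / sqrt 2) * (norm X)\<^sup>2)"
proof (cases "s = t")
  case False
  with st have pos: "t - s > 0" by simp
  have *: "(log_at t - log_at s) \<bullet> X \<le> (t - s) * (psi (D / sqrt 2 + h) * (norm X)\<^sup>2)" if h: "h > 0" for h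
  proof -
    have "(\<lambda>N. norm (msinh (((t - s) / 2 / real N) *\<^sub>R X))) \<longlonglongrightarrow> norm (0 :: real^'a^'a)"
      by (intro tendsto_norm msinh_limit_zero X)
    then have "eventually (\<lambda>N. norm (msinh (((t - s) / 2 / real N) *\<^sub>R X)) < tanh h) sequentially"
      using h by (intro order_tendstoD(2)[where y = 0]) simp_all
    then have ev: "eventually (\<lambda>N. (log_at t - log_at s) \<bullet> (real N *\<^sub>R msinh (((t - s) / real N) *\<^sub>R X))
    \<le> 4 * (psi (D / sqrt 2 + h) * (norm (real N *\<^sub>R msinh (((t - s) / 2 / real N) *\<^sub>R X)))\<^sup>2)) sequentially"
      using eventually_gt_at_top[of 0]
      by eventually_elim (rule slope_upper_step[OF st D h]; assumption)
    have "(log_at t - log_at s) \<bullet> ((t - s) *\<^sub>R X) \<le> 4 * (psi (D / sqrt 2 + h) * (norm (((t - s) / 2) *\<^sub>R X))\<^sup>2)"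
      by (rule tendsto_le[OF sequentially_bot _ _ ev])
         (intro tendsto_mult tendsto_const tendsto_power tendsto_norm tendsto_inner msinh_limit X)+
    then have "(t - s) * ((log_at t - log_at s) \<bullet> X) \<le> (t - s) * ((t - s) * (psi (D / sqrt 2 + h) * (norm X)\<^sup>2))"
      using pos by (simp add: power_mult_distrib power2_eq_square mult_ac)
    then show ?thesis using pos by simp
  qed
  have "((\<lambda>h. D / sqrt 2 + h) \<longlongrightarrow> D / sqrt 2 + 0) (at_right 0)" by (intro tendsto_intros)
  then have "((\<lambda>h. psi (D / sqrt 2 + h)) \<longlongrightarrow> psi (D / sqrt 2)) (at_right 0)"
    using isCont_tendsto_compose[OF isCont_psi] by fastforce
  then have "((\<lambda>h. (t - s) * (psi (D / sqrt 2 + h) * (norm X)\<^sup>2)) \<longlongrightarrow> (t - s) * (psi (D / sqrt 2) * (norm X)\<^sup>2)) (at_right 0)"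
    by (intro tendsto_intros)
  then show ?thesis
    by (rule tendsto_lowerbound) (auto simp: eventually_at_right_less intro!: eventually_mono[OF eventually_at_right_less[of 0]] *)
qed simp

definition energy :: "real \<Rightarrow> real" where "energy s = (norm (log_at s))\<^sup>2 / 2"

definition slope :: "real \<Rightarrow> real" where "slope s = log_at s \<bullet> X"

text \<open>
This is the law of cosines of a nonpositively curved space, written as a first-order bound at $s$.
\<close>

lemma energy_strongly_convex: "energy s + (t - s) * slope s + (t - s)\<^sup>2 / 2 * (norm X)\<^sup>2 \<le> energy t"
proof -
  have "(norm (log_at s + (t - s) *\<^sub>R X))\<^sup>2 \<le> (norm (log_at t))\<^sup>2"
    using norm_log_at_ge by (intro power_mono) auto
  moreover have "(norm (log_at s + c *\<^sub>R X))\<^sup>2 = (norm (log_at s))\<^sup>2 + 2 * (c * slope s) + c\<^sup>2 * (norm X)\<^sup>2" for c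
    unfolding slope_def power2_norm_eq_inner
    by (simp add: inner_add_left inner_add_right inner_commute power2_eq_square)
  ultimately show ?thesis unfolding energy_def by simp
qed

lemma energy_convex: "energy s + (t - s) * slope s \<le> energy t"
  using energy_strongly_convex[of s t] by (smt (verit) mult_nonneg_nonneg zero_le_divide_iff zero_le_power2)

lemma slope_mono: "s \<le> t \<Longrightarrow> slope s \<le> slope t"
proof -
  assume "s \<le> t"
  moreover have "(t - s) * (slope t - slope s) \<ge> 0"
    using energy_convex[of s t] energy_convex[of t s] by (simp add: algebra_simps)
  ultimately show ?thesis by (cases "s = t") (auto simp: zero_le_mult_iff)
qed

text \<open>
The subgradient at $r$ has a sign, and the bound at the corresponding endpoint finishes.
\<close>

lemma energy_convex_bound:
  assumes "0 \<le> r" "r \<le> t" "energy t \<le> energy 0" shows "energy r \<le> energy 0"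
proof (cases "slope r \<ge> 0")
  case True
  then show ?thesis using energy_convex[of r t] assms mult_nonneg_nonneg[of "t - r" "slope r"] by linarith
next
  case False
  then have "(0 - r) * slope r \<ge> 0" using assms by (intro mult_nonpos_nonpos) auto
  then show ?thesis using energy_convex[of r 0] by linarith
qed

text \<open>
The subgradient inequalities at $s$ and at $t$ put the difference quotient between the two slopes,
and the slope is locally Lipschitz. So differentiability follows from the two-sided bounds, without
any differentiability of the logarithm.
\<close>

lemma energy_has_derivative: "(energy has_real_derivative slope s) (at s)"
proof -
  \<comment> \<open>The distance changes at most at the speed of the path, so this radius works for all parameters within 1 of s.\<close>
  define D where "D = norm (log_at s) + norm X"
  define C where "C = psi (D / sqrt 2) * (norm X)\<^sup>2"
  have D: "norm (log_at r) \<le> D" if "\<bar>r - s\<bar> \<le> 1" for r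
  proof -
    have "norm (log_at r) \<le> norm (log_at r + (s - r) *\<^sub>R X) + norm ((s - r) *\<^sub>R X)"
      using norm_triangle_ineq4[of "log_at r + (s - r) *\<^sub>R X" "(s - r) *\<^sub>R X"] by simp
    also have "\<dots> \<le> norm (log_at s) + 1 * norm X"
      unfolding norm_scaleR using that by (intro add_mono norm_log_at_ge mult_right_mono) auto
    finally show ?thesis by (simp add: D_def)
  qed
  have est: "\<bar>(energy t - energy s) / (t - s) - slope s\<bar> \<le> C * \<bar>t - s\<bar>" if "t \<noteq> s" "\<bar>t - s\<bar> \<le> 1" for t
  proof -
    have C: "\<bar>slope t - slope s\<bar> \<le> C * \<bar>t - s\<bar>"
    proof (cases "s \<le> t")
      case True
      then show ?thesis using slope_upper[OF True, of D] slope_mono[OF True] D that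
        by (simp add: C_def slope_def inner_diff_left mult_ac)
    next
      case False
      then have ts: "t \<le> s" by simp
      then show ?thesis using slope_upper[OF ts, of D] slope_mono[OF ts] D that
        by (simp add: C_def slope_def inner_diff_left mult_ac)
    qed
    have 1: "energy s + (t - s) * slope s \<le> energy t" "energy t + (s - t) * slope t \<le> energy s"
      by (rule energy_convex)+
    have 2: "\<bar>(energy t - energy s) / (t - s) - slope s\<bar> \<le> \<bar>slope t - slope s\<bar>"
    proof (cases "t > s")
      case True
      then have "slope s \<le> (energy t - energy s) / (t - s)" "(energy t - energy s) / (t - s) \<le> slope t"
        using 1 by (auto simp: field_simps)
      then show ?thesis by linarith
    next
      case False
      then have "(energy t - energy s) / (t - s) \<le> slope s" "slope t \<le> (energy t - energy s) / (t - s)"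
        using 1 that by (auto simp: field_simps)
      then show ?thesis by linarith
    qed
    with C show ?thesis by linarith
  qed
  have "((\<lambda>t. (energy t - energy s) / (t - s) - slope s) \<longlongrightarrow> 0) (at s)"
  proof (rule Lim_null_comparison)
    show "\<forall>\<^sub>F t in at s. norm ((energy t - energy s) / (t - s) - slope s) \<le> C * \<bar>t - s\<bar>"
      unfolding eventually_at by (intro exI[of _ 1]) (auto simp: dist_real_def intro!: est)
    have "((\<lambda>t. C * \<bar>t - s\<bar>) \<longlongrightarrow> C * \<bar>s - s\<bar>) (at s)" by (intro tendsto_intros)
    then show "((\<lambda>t. C * \<bar>t - s\<bar>) \<longlongrightarrow> 0) (at s)" by simp
  qed
  then show ?thesis unfolding has_field_derivative_iff by (rule LIM_zero_cancel)
qed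

text \<open>
The bound on the increase of the slope, integrated once.
\<close>

lemma energy_upper:
  assumes t: "0 \<le> t" and D: "\<And>r. 0 \<le> r \<Longrightarrow> r \<le> t \<Longrightarrow> norm (log_at r) \<le> D"
  shows "energy t \<le> energy 0 + t * slope 0 + t\<^sup>2 / 2 * (psi (D / sqrt 2) * (norm X)\<^sup>2)"
proof -
  define K where "K = psi (D / sqrt 2) * (norm X)\<^sup>2"
  define e where "e r = energy 0 + r * slope 0 + r\<^sup>2 / 2 * K - energy r" for r
  have "e 0 \<le> e t"
  proof (rule DERIV_nonneg_imp_nondecreasing[OF t])
    fix r assume r: "0 \<le> r" "r \<le> t"
    have "(e has_real_derivative (slope 0 + r * K - slope r)) (at r)"
      unfolding e_def by (auto intro!: derivative_eq_intros energy_has_derivative)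
    moreover have "slope r - slope 0 \<le> r * K"
      using slope_upper[of 0 r D] r D by (simp add: slope_def inner_diff_left K_def)
    ultimately show "\<exists>y. (e has_real_derivative y) (at r) \<and> 0 \<le> y" by force
  qed
  then show ?thesis by (simp add: e_def K_def)
qed

text \<open>
A step short enough for the quadratic bound to predict strict decrease cannot leave the sublevel
set. Otherwise the energy would first drop and later return to its initial value at some $\tau$;
by convexity the path up to $\tau$ stays in the ball, and the quadratic bound at $\tau$ gives a
strict decrease, a contradiction.
\<close>

lemma energy_descent:
  assumes \<eta>: "0 < \<eta>" and D: "norm (log_at 0) \<le> D"
    and desc: "\<eta> / 2 * (psi (D / sqrt 2) * (norm X)\<^sup>2) < - slope 0"
  shows "energy \<eta> \<le> energy 0 + \<eta> * slope 0 + \<eta>\<^sup>2 / 2 * (psi (D / sqrt 2) * (norm X)\<^sup>2)"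
proof -
  define K where "K = psi (D / sqrt 2) * (norm X)\<^sup>2"
  have K: "K \<ge> 0" unfolding K_def using psi_ge_1[of "D / sqrt 2"] by (intro mult_nonneg_nonneg) auto
  have upper: "energy t \<le> energy 0 + t * slope 0 + t\<^sup>2 / 2 * K" if "0 \<le> t" "energy t \<le> energy 0" for t
    unfolding K_def
  proof (rule energy_upper)
    fix r assume "0 \<le> r" "r \<le> t"
    then have "energy r \<le> energy 0" using energy_convex_bound that by blast
    then have "norm (log_at r) \<le> norm (log_at 0)" by (simp add: energy_def abs_le_square_iff[symmetric])
    then show "norm (log_at r) \<le> D" using D by simp
  qed (use that in auto)
  have "energy \<eta> \<le> energy 0"
  proof (rule ccontr)
    assume up: "\<not> energy \<eta> \<le> energy 0"
    have "slope 0 < 0" using desc K \<eta> unfolding K_def[symmetric]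
      by (smt (verit) mult_nonneg_nonneg zero_le_divide_iff)
    from DERIV_neg_dec_right[OF energy_has_derivative this] obtain d where d: "d > 0" "\<And>h. 0 < h \<Longrightarrow> h < d \<Longrightarrow> energy h < energy 0"
      by auto
    define r where "r = min (d / 2) (\<eta> / 2)"
    have r: "0 < r" "r < \<eta>" "energy r < energy 0" using d \<eta> by (auto simp: r_def min_def)
    have "continuous_on {r..\<eta>} energy"
      by (intro continuous_at_imp_continuous_on ballI DERIV_isCont[OF energy_has_derivative])
    then obtain \<tau> where \<tau>: "r \<le> \<tau>" "\<tau> \<le> \<eta>" "energy \<tau> = energy 0"
      using IVT'[of energy r "energy 0" \<eta>] r up by auto
    have "\<tau> > 0" using r \<tau> by simp
    from upper[of \<tau>] \<tau> this have "0 \<le> \<tau> * (slope 0 + \<tau> / 2 * K)" by (simp add: power2_eq_square algebra_simps)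
    with \<open>\<tau> > 0\<close> have "0 \<le> slope 0 + \<tau> / 2 * K" by (simp add: zero_le_mult_iff)
    moreover have "\<tau> / 2 * K \<le> \<eta> / 2 * K" using \<tau> K by (intro mult_right_mono) auto
    ultimately show False using desc by (simp add: K_def)
  qed
  then show ?thesis using upper \<eta> by (simp add: K_def)
qed

end

section \<open>Squared distance along an arbitrary geodesic\<close>

lemma geodesic_spd:
  assumes "P \<in> spd" "transpose H = H" shows "msqrt P ** mexp H ** msqrt P \<in> spd"
proof -
  note S = msqrt_spd_square[OF assms(1)]
  show ?thesis
    using spd_congruence_invertible[OF mexp_spd[OF assms(2)] spd_invertible[OF S(1)]] spd_symmetric[OF S(1)] by simp
qed

text \<open>
Congruence by $P^{-1/2}$ moves the geodesic from $P$ with velocity $H$ to a ray through the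
identity. The ray is parametrized with velocity $-X$, hence the sign of $H$.
\<close>

locale spd_geodesic =
  fixes R P H :: "real^'a::finite^'a"
  assumes R_spd: "R \<in> spd" and P_spd: "P \<in> spd" and H_sym: "transpose H = H"
begin

definition "residual = mlog (matrix_inv (msqrt P) ** R ** matrix_inv (msqrt P))"
definition "point t = msqrt P ** mexp (t *\<^sub>R H) ** msqrt P"

lemma whitened_spd: "matrix_inv (msqrt P) ** R ** matrix_inv (msqrt P) \<in> spd"
  using spd_congruence_invertible[OF R_spd spd_invertible[OF msqrt_inverse_whitens(1)[OF P_spd]]]
  by (simp add: msqrt_inverse_whitens(2)[OF P_spd])

sublocale ray: spd_ray "matrix_inv (msqrt P) ** R ** matrix_inv (msqrt P)" "- H"
  by unfold_locales (simp_all add: whitened_spd H_sym transpose_minus)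

lemma point_spd: "point t \<in> spd"
  unfolding point_def using H_sym by (intro geodesic_spd P_spd) simp

lemma point_0: "point 0 = P"
  by (simp add: point_def msqrt_spd_square[OF P_spd])

lemma norm_log_at_point: "norm (ray.log_at t) = d_AI R (point t)"
proof -
  let ?Y = "matrix_inv (msqrt P)" and ?S = "msqrt P"
  note Y = msqrt_inverse_whitens[OF P_spd] and S = msqrt_spd_square[OF P_spd]
  have "norm (ray.log_at t) = d_AI (mexp (t *\<^sub>R H)) (?Y ** R ** ?Y)"
    by (simp add: ray.norm_log_at)
  also have "\<dots> = d_AI (?S ** mexp (t *\<^sub>R H) ** transpose ?S) (?S ** (?Y ** R ** ?Y) ** transpose ?S)"
    by (rule d_AI_congruence[symmetric]) (simp_all add: mexp_spd H_sym whitened_spd spd_invertible S)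
  also have "?S ** (?Y ** R ** ?Y) ** transpose ?S = (?S ** ?Y) ** R ** (?Y ** ?S)"
    by (simp add: spd_symmetric[OF S(1)] matrix_mul_assoc)
  also have "\<dots> = R" by (simp add: Y)
  also have "?S ** mexp (t *\<^sub>R H) ** transpose ?S = point t"
    by (simp add: point_def spd_symmetric[OF S(1)])
  also have "d_AI (point t) R = d_AI R (point t)" by (rule d_AI_commute[OF point_spd R_spd])
  finally show ?thesis .
qed

lemma log_at_0: "ray.log_at 0 = residual"
  by (simp add: ray.log_at_def residual_def)

lemma slope_0: "ray.slope 0 = - (residual \<bullet> H)"
  by (simp add: ray.slope_def log_at_0)

lemma squared_distance_strongly_convex:
  "(d_AI R P)\<^sup>2 / 2 - residual \<bullet> H + (norm H)\<^sup>2 / 2 \<le> (d_AI R (point 1))\<^sup>2 / 2"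
  using ray.energy_strongly_convex[of 0 1] by (simp add: ray.energy_def norm_log_at_point point_0 slope_0)

lemma squared_distance_descent:
  assumes "0 < \<eta>" "d_AI R P \<le> D" "\<eta> / 2 * (psi (D / sqrt 2) * (norm H)\<^sup>2) < residual \<bullet> H"
  shows "(d_AI R (point \<eta>))\<^sup>2 / 2 \<le> (d_AI R P)\<^sup>2 / 2 - \<eta> * (residual \<bullet> H) + \<eta>\<^sup>2 / 2 * (psi (D / sqrt 2) * (norm H)\<^sup>2)"
  using ray.energy_descent[of \<eta> D] assms by (simp add: ray.energy_def norm_log_at_point point_0 slope_0)

text \<open>
Strong convexity taken at the midpoint towards both ends: the first-order terms cancel.
\<close>

lemma semiparallelogram:
  "2 * (d_AI R (point (1/2)))\<^sup>2 + (norm H)\<^sup>2 / 2 \<le> (d_AI R P)\<^sup>2 + (d_AI R (point 1))\<^sup>2"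
  using ray.energy_strongly_convex[of "1/2" 0] ray.energy_strongly_convex[of "1/2" 1]
  by (simp add: ray.energy_def norm_log_at_point point_0 power2_eq_square)

end

section \<open>Existence and uniqueness of the canonical controller\<close>

lemma exp_diff_le:
  fixes a b c :: real assumes "a \<le> c" "b \<le> c" shows "\<bar>exp a - exp b\<bar> \<le> exp c * \<bar>a - b\<bar>"
proof -
  have *: "exp a - exp b \<le> exp c * (a - b)" if "b \<le> a" "a \<le> c" for a b
  proof -
    have "exp a - exp b = exp a * (1 - exp (b - a))" by (simp add: exp_diff algebra_simps)
    also have "1 - exp (b - a) \<le> a - b" using exp_ge_add_one_self[of "b - a"] by linarith
    then have "exp a * (1 - exp (b - a)) \<le> exp a * (a - b)" by (intro mult_left_mono) auto
    also have "\<dots> \<le> exp c * (a - b)" using that by (intro mult_right_mono) auto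
    finally show ?thesis .
  qed
  show ?thesis
  proof (cases "b \<le> a")
    case True then show ?thesis using *[of b a] assms by simp
  next
    case False then show ?thesis using *[of a b] assms by simp
  qed
qed

lemma eigenvalue_le_norm: "eigenbasis u l X \<Longrightarrow> \<bar>l i\<bar> \<le> norm X"
proof -
  assume u: "eigenbasis u l X"
  have "(l i)\<^sup>2 \<le> (norm X)\<^sup>2" unfolding norm2_eigenbasis[OF u] by (rule member_le_sum) auto
  then show ?thesis by (simp add: abs_le_square_iff[symmetric])
qed

text \<open>
The scalar Lipschitz bound for $\exp$ transfers entrywise in the mixed eigenbases.
\<close>

lemma mexp_lipschitz:
  assumes X: "transpose X = X" "norm X \<le> c" and Y: "transpose Y = Y" "norm Y \<le> c"
  shows "norm (mexp X - mexp Y) \<le> exp c * norm (X - Y)"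
proof -
  obtain u l where u: "eigenbasis u l X" using spectral_theorem[OF X(1)] .
  obtain v m where v: "eigenbasis v m Y" using spectral_theorem[OF Y(1)] .
  note B = eigenbasisD(1)[OF u] eigenbasisD(1)[OF v]
  have "(norm (mexp X - mexp Y))\<^sup>2 \<le> (exp c)\<^sup>2 * (norm (X - Y))\<^sup>2"
    unfolding norm2_matrix_two_bases[OF B] sum_distrib_left two_eigenbases[OF u v]
      two_eigenbases[OF eigenbasis_mexp[OF u] eigenbasis_mexp[OF v]]
  proof (intro sum_mono)
    fix i j
    have "\<bar>exp (l i) - exp (m j)\<bar> \<le> exp c * \<bar>l i - m j\<bar>"
      using eigenvalue_le_norm[OF u, of i] eigenvalue_le_norm[OF v, of j] X Y by (intro exp_diff_le) auto
    then have "(exp (l i) - exp (m j))\<^sup>2 \<le> (exp c * (l i - m j))\<^sup>2"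
      by (simp add: abs_le_square_iff[symmetric] abs_mult)
    then show "((exp (l i) - exp (m j)) * (u i \<bullet> v j))\<^sup>2 \<le> (exp c)\<^sup>2 * ((l i - m j) * (u i \<bullet> v j))\<^sup>2"
      using mult_right_mono[of _ _ "(u i \<bullet> v j)\<^sup>2"] by (simp add: power_mult_distrib mult.assoc[symmetric])
  qed
  then show ?thesis by (simp add: power_mult_distrib[symmetric] abs_le_square_iff[symmetric])
qed

lemma mexp_tendsto:
  assumes "\<And>k. transpose (Y k) = Y k" "transpose Z = Z" "Y \<longlonglongrightarrow> Z"
  shows "(\<lambda>k. mexp (Y k)) \<longlonglongrightarrow> mexp Z"
proof -
  have "Bseq Y" using assms(3) convergent_imp_Bseq convergent_def by blast
  then obtain c0 where c0: "\<And>k. norm (Y k) \<le> c0" by (auto simp: Bseq_def)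
  define c where "c = max c0 (norm Z)"
  have "(\<lambda>k. norm (Y k - Z)) \<longlonglongrightarrow> 0" using assms(3) LIM_zero tendsto_norm_zero by blast
  then have l: "(\<lambda>k. exp c * norm (Y k - Z)) \<longlonglongrightarrow> 0" by (rule tendsto_mult_right_zero)
  have "(\<lambda>k. mexp (Y k) - mexp Z) \<longlonglongrightarrow> 0"
    by (rule Lim_null_comparison[OF _ l])
       (use c0 in \<open>auto intro!: always_eventually mexp_lipschitz assms simp: c_def le_max_iff_disj\<close>)
  then show ?thesis by (rule LIM_zero_cancel)
qed

text \<open>
In logarithmic coordinates the feasible set is closed, the condition $\det P = 1$ becomes linear, and
the distance from $I$ is the Frobenius norm. A minimizer is thus a closest point to the origin.
\<close>

lemma closed_log_feasible:
  "closed {Y :: real^'a::finite^'a. transpose Y = Y \<and> trace Y = 0 \<and> mexp Y ** (A :: real^'b::finite^'a) = B}"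
  unfolding closed_sequential_limits
proof (intro allI impI, elim conjE)
  fix Y :: "nat \<Rightarrow> real^'a^'a" and Z
  assume Y: "\<forall>n. Y n \<in> {Y. transpose Y = Y \<and> trace Y = 0 \<and> mexp Y ** A = B}" and lim: "Y \<longlonglongrightarrow> Z"
  have "bounded_linear (transpose :: real^'a^'a \<Rightarrow> real^'a^'a)"
    by (intro linear_conv_bounded_linear[THEN iffD1] linearI) (simp_all add: transpose_add)
  from bounded_linear.tendsto[OF this lim] have "Y \<longlonglongrightarrow> transpose Z" using Y by simp
  with lim have tZ: "transpose Z = Z" using LIMSEQ_unique by blast
  have "bounded_linear (trace :: real^'a^'a \<Rightarrow> real)"
    by (intro linear_conv_bounded_linear[THEN iffD1] linearI)
       (simp_all add: trace_def sum.distrib sum_distrib_left)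
  from bounded_linear.tendsto[OF this lim] have "(\<lambda>_. 0) \<longlonglongrightarrow> trace Z" using Y by simp
  then have rZ: "trace Z = 0" using LIMSEQ_unique tendsto_const by metis
  have "bounded_linear (\<lambda>X :: real^'a^'a. X ** A)"
    by (intro linear_conv_bounded_linear[THEN iffD1] linearI)
       (simp_all add: vec_eq_iff matrix_matrix_mult_def sum_distrib_left sum.distrib ring_distribs mult_ac)
  from bounded_linear.tendsto[OF this mexp_tendsto[OF _ tZ lim]] have "(\<lambda>_. B) \<longlonglongrightarrow> mexp Z ** A" using Y by simp
  then have "mexp Z ** A = B" using LIMSEQ_unique tendsto_const by metis
  with tZ rZ show "Z \<in> {Y. transpose Y = Y \<and> trace Y = 0 \<and> mexp Y ** A = B}" by simp
qed

lemma mexp_spd1_iff: "transpose Y = Y \<Longrightarrow> mexp Y \<in> spd1 \<longleftrightarrow> trace Y = 0"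
  by (simp add: spd1_def mexp_spd det_mexp)

text \<open>
With $E = e^{H/2}$ and $y = Ex - x$, the hypothesis gives $Ey = -y$, which a positive definite
$E$ allows only for $y = 0$.
\<close>

lemma mexp_half_fixes:
  assumes "transpose H = H" "mexp H *v x = x" shows "mexp ((1/2) *\<^sub>R H) *v x = x"
proof -
  let ?E = "mexp ((1/2) *\<^sub>R H)"
  have spd: "?E \<in> spd" using assms by (intro mexp_spd) simp
  define y where "y = ?E *v x - x"
  have "?E *v (?E *v x) = x" using assms mexp_half[OF assms(1)] by (simp add: matrix_vector_mul_assoc)
  then have "?E *v y = - y" by (simp add: y_def matrix_vector_mult_diff_distrib)
  then have "y \<bullet> (?E *v y) = - (y \<bullet> y)" by simp
  then have "y = 0" using spd by (auto simp: spd_def) (metis inner_ge_zero neg_0_less_iff_less not_less)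
  then show ?thesis by (simp add: y_def)
qed

lemma mexp_half_fixes_matrix:
  fixes A :: "real^'b::finite^'a::finite"
  assumes "transpose H = H" "mexp H ** A = A" shows "mexp ((1/2) *\<^sub>R H) ** A = A"
proof -
  have "mexp H *v (A *v x) = A *v x" for x by (simp add: matrix_vector_mul_assoc assms)
  then have "mexp ((1/2) *\<^sub>R H) *v (A *v x) = A *v x" for x by (rule mexp_half_fixes[OF assms(1)])
  then show ?thesis by (simp add: matrix_eq matrix_vector_mul_assoc)
qed

text \<open>
The feasible set contains geodesic midpoints. The equation $PA = P'A$ says that $e^{H}$ fixes
$P^{1/2}A$, so $e^{H/2}$ fixes it too.
\<close>

lemma feasible_midpoint:
  fixes A :: "real^'b::finite^'a::finite"
  assumes P: "P \<in> spd1" "P ** A = B" and P': "msqrt P ** mexp H ** msqrt P \<in> spd1" "msqrt P ** mexp H ** msqrt P ** A = B"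
    and H: "transpose H = H"
  shows "msqrt P ** mexp ((1/2) *\<^sub>R H) ** msqrt P \<in> spd1" "msqrt P ** mexp ((1/2) *\<^sub>R H) ** msqrt P ** A = B"
proof -
  have Pspd: "P \<in> spd" using P by (simp add: spd1_def)
  let ?S = "msqrt P" and ?Y = "matrix_inv (msqrt P)"
  note S = msqrt_spd_square[OF Pspd] and Y = msqrt_inverse_whitens[OF Pspd]
  have "det ?S * det ?S = 1" using P(1) S(2) by (metis (mono_tags, lifting) det_mul mem_Collect_eq spd1_def)
  moreover have "det (?S ** mexp H ** ?S) = 1" using P' by (simp add: spd1_def)
  ultimately have "det (mexp H) = 1" by (simp add: det_mul mult_ac)
  then have tr: "trace H = 0" by (simp add: det_mexp[OF H])
  have "trace ((1/2) *\<^sub>R H) = 0" using tr by (simp add: trace_def flip: sum_divide_distrib)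
  then have "det (mexp ((1/2) *\<^sub>R H)) = 1" using H by (simp add: det_mexp)
  with \<open>det ?S * det ?S = 1\<close> show "?S ** mexp ((1/2) *\<^sub>R H) ** ?S \<in> spd1"
    using H by (simp add: spd1_def det_mul mult_ac geodesic_spd Pspd)
  have "?S ** (mexp H ** (?S ** A)) = ?S ** (?S ** A)"
    using P(2) P'(2) S(2) by (simp add: matrix_mul_assoc)
  then have "?Y ** (?S ** (mexp H ** (?S ** A))) = ?Y ** (?S ** (?S ** A))" by simp
  then have "mexp H ** (?S ** A) = ?S ** A"
    by (simp only: matrix_mul_assoc[of ?Y ?S] Y matrix_mul_lid)
  from mexp_half_fixes_matrix[OF H this] have "?S ** (mexp ((1/2) *\<^sub>R H) ** (?S ** A)) = ?S ** (?S ** A)" by simp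
  then show "?S ** mexp ((1/2) *\<^sub>R H) ** ?S ** A = B"
    using P(2) S(2) by (simp add: matrix_mul_assoc)
qed

text \<open>
Existence is a closest-point argument in logarithmic coordinates. Two minimizers coincide, since
otherwise their midpoint is feasible and strictly closer by the semiparallelogram inequality.
Uniqueness is what makes the definite description in the definition of the controller meaningful.
\<close>

theorem controller_minimizes:
  fixes A B :: "real^'b::finite^'a::finite"
  assumes "P0 \<in> spd1" "P0 ** A = B"
  shows "is_arg_min (d_AI (mat 1)) (\<lambda>P. P \<in> spd1 \<and> P ** A = B) (controller A B)"
proof -
  define K where "K = {Y :: real^'a^'a. transpose Y = Y \<and> trace Y = 0 \<and> mexp Y ** A = B}"
  have feas: "\<exists>Y\<in>K. P = mexp Y" if "P \<in> spd1" "P ** A = B" for P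
  proof -
    have "P \<in> spd" using that by (simp add: spd1_def)
    then obtain Y where "transpose Y = Y" "mexp Y = P" by (rule spd_mexpE) blast
    then show ?thesis using that mexp_spd1_iff[of Y] by (auto simp: K_def)
  qed
  have d: "d_AI (mat 1) (mexp Y) = norm Y" if "Y \<in> K" for Y
    using that by (intro d_AI_identity_mexp) (simp add: K_def)
  have "closed K" unfolding K_def by (rule closed_log_feasible)
  moreover have "K \<noteq> {}" using feas[OF assms] by auto
  ultimately obtain Y where Y: "Y \<in> K" "\<And>Z. Z \<in> K \<Longrightarrow> dist 0 Y \<le> dist 0 Z"
    by (rule distance_attains_inf) blast
  have min: "is_arg_min (d_AI (mat 1)) (\<lambda>P. P \<in> spd1 \<and> P ** A = B) (mexp Y)"
    unfolding is_arg_min_def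
  proof (intro conjI notI)
    show "mexp Y \<in> spd1" "mexp Y ** A = B" using Y(1) mexp_spd1_iff by (auto simp: K_def)
    assume "\<exists>P. (P \<in> spd1 \<and> P ** A = B) \<and> d_AI (mat 1) P < d_AI (mat 1) (mexp Y)"
    then obtain Z where "Z \<in> K" "d_AI (mat 1) (mexp Z) < d_AI (mat 1) (mexp Y)" using feas by blast
    then show False using d Y by (auto simp: not_le[symmetric])
  qed
  have unique: "P = Q" if P: "is_arg_min (d_AI (mat 1)) (\<lambda>P. P \<in> spd1 \<and> P ** A = B) P"
     and Q: "is_arg_min (d_AI (mat 1)) (\<lambda>P. P \<in> spd1 \<and> P ** A = B) Q" for P Q
  proof -
    have PQ: "P \<in> spd" "Q \<in> spd" "P \<in> spd1" "Q \<in> spd1" "P ** A = B" "Q ** A = B"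
      using P Q by (auto simp: is_arg_min_def spd1_def)
    define H where "H = mlog (matrix_inv (msqrt P) ** Q ** matrix_inv (msqrt P))"
    note H = geodesic_to[OF PQ(1,2), folded H_def]
    interpret spd_geodesic "mat 1" P H by unfold_locales (use PQ H mat1_spd in auto)
    have p1: "point 1 = Q" by (simp add: point_def H)
    have "point (1/2) \<in> spd1 \<and> point (1/2) ** A = B"
      unfolding point_def using feasible_midpoint[OF PQ(3,5) _ _ H(1)] PQ by (simp add: H)
    then have m: "d_AI (mat 1) P \<le> d_AI (mat 1) (point (1/2))" "d_AI (mat 1) Q \<le> d_AI (mat 1) (point (1/2))"
      using P Q by (auto simp: is_arg_min_def not_less)
    have nn: "0 \<le> d_AI (mat 1) X" for X :: "real^'a^'a" by (simp add: d_AI_def)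
    have "(d_AI (mat 1) P)\<^sup>2 \<le> (d_AI (mat 1) (point (1/2)))\<^sup>2" "(d_AI (mat 1) Q)\<^sup>2 \<le> (d_AI (mat 1) (point (1/2)))\<^sup>2"
      using m nn by (auto intro: power_mono)
    then have "(norm H)\<^sup>2 \<le> 0" using semiparallelogram unfolding p1 by linarith
    then have "H = 0" by simp
    then show "P = Q" using H(2) msqrt_spd_square[OF PQ(1)] by simp
  qed
  show ?thesis unfolding controller_def
    by (rule theI[where P = "is_arg_min (d_AI (mat 1)) (\<lambda>P. P \<in> spd1 \<and> P ** A = B)"]) (fact min, erule unique, fact min)
qed

section \<open>Block matrices\<close>

definition join :: "real^'m \<Rightarrow> real^'n \<Rightarrow> real^('m::finite + 'n::finite)" where
  "join x y = (\<chi> k. case k of Inl a \<Rightarrow> x $ a | Inr b \<Rightarrow> y $ b)"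

lemma sum_UNIV_sum:
  "(\<Sum>i\<in>(UNIV :: ('m::finite + 'n::finite) set). f i) = (\<Sum>i\<in>UNIV. f (Inl i)) + (\<Sum>i\<in>UNIV. f (Inr i))"
  by (simp add: UNIV_Plus_UNIV[symmetric] sum.Plus del: UNIV_Plus_UNIV)

lemma prod_UNIV_sum:
  "(\<Prod>i\<in>(UNIV :: ('m::finite + 'n::finite) set). f i) = (\<Prod>i\<in>UNIV. f (Inl i)) * (\<Prod>i\<in>UNIV. f (Inr i))"
  by (simp add: UNIV_Plus_UNIV[symmetric] prod.Plus del: UNIV_Plus_UNIV)

lemma vec_eq_iff_sum: "x = y \<longleftrightarrow> (\<forall>i. x $ Inl i = y $ Inl i) \<and> (\<forall>i. x $ Inr i = y $ Inr i)"
  by (simp add: vec_eq_iff split_sum_all)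

lemma four_block_mult:
  "four_block A B C D ** four_block A' B' C' D' =
   four_block (A ** A' + B ** C') (A ** B' + B ** D') (C ** A' + D ** C') (C ** B' + D ** D')"
  by (simp add: vec_eq_iff_sum four_block_def matrix_matrix_mult_def sum_UNIV_sum)

lemma transpose_four_block:
  "transpose (four_block A B C D) = four_block (transpose A) (transpose C) (transpose B) (transpose D)"
  by (simp add: vec_eq_iff_sum four_block_def transpose_def)

lemma four_block_mat1: "four_block (mat 1) 0 0 (mat 1) = mat 1"
  by (simp add: vec_eq_iff_sum four_block_def mat_def)

lemma scaleR_four_block: "c *\<^sub>R four_block A B C D = four_block (c *\<^sub>R A) (c *\<^sub>R B) (c *\<^sub>R C) (c *\<^sub>R D)"
  by (simp add: vec_eq_iff_sum four_block_def)

lemma four_block_join: "four_block A B C D *v join x y = join (A *v x + B *v y) (C *v x + D *v y)"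
  by (simp add: vec_eq_iff_sum four_block_def join_def matrix_vector_mult_def sum_UNIV_sum)

lemma inner_join: "join x y \<bullet> join x' y' = x \<bullet> x' + y \<bullet> y'"
  by (simp add: inner_vec_def join_def sum_UNIV_sum)

lemma inner_four_block_lower_right: "Y \<bullet> four_block 0 0 0 X = lower_right Y \<bullet> X"
  by (simp add: inner_vec_def four_block_def lower_right_def sum_UNIV_sum)

lemma lower_right_four_block: "lower_right (four_block A B C X) = X"
  by (simp add: vec_eq_iff lower_right_def four_block_def)

lemma norm_four_block_lower_right: "norm (four_block 0 0 0 X) = norm X"
  by (simp add: norm_eq_sqrt_inner inner_four_block_lower_right lower_right_four_block)

text \<open>
All block-diagonal facts below (exponential, positivity, determinant) are read off from this basis.
\<close>

lemma eigenbasis_four_block: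
  assumes "eigenbasis u l P" "eigenbasis v m S"
  shows "eigenbasis (case_sum (\<lambda>i. join (u i) 0) (\<lambda>j. join 0 (v j))) (case_sum l m) (four_block P 0 0 S)"
proof -
  have "c *\<^sub>R join x y = join (c *\<^sub>R x) (c *\<^sub>R y)" for c and x :: "real^'a" and y :: "real^'b"
    by (simp add: vec_eq_iff_sum join_def)
  then show ?thesis using assms
    by (simp add: eigenbasis_def orthonormal_basis_def split_sum_all four_block_join inner_join)
qed

lemma symmetric_four_block:
  "transpose P = P \<Longrightarrow> transpose S = S \<Longrightarrow> transpose (four_block P 0 0 S) = four_block P 0 0 S"
  by (simp add: transpose_four_block) (simp add: transpose_def vec_eq_iff zero_vec_def)

lemma mexp_four_block:
  assumes "transpose X = X" "transpose H = H"
  shows "mexp (four_block X 0 0 H) = four_block (mexp X) 0 0 (mexp H)"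
proof -
  obtain u l where u: "eigenbasis u l X" using spectral_theorem[OF assms(1)] .
  obtain v m where v: "eigenbasis v m H" using spectral_theorem[OF assms(2)] .
  have "(\<lambda>i. exp (case_sum l m i)) = case_sum (\<lambda>i. exp (l i)) (\<lambda>i. exp (m i))"
    by (auto simp: fun_eq_iff split: sum.splits)
  with eigenbasis_mexp[OF eigenbasis_four_block[OF u v]] eigenbasis_four_block[OF eigenbasis_mexp[OF u] eigenbasis_mexp[OF v]]
  show ?thesis by (auto intro: eigenbasis_unique)
qed

lemma spd_four_block:
  assumes "P \<in> spd" "S \<in> spd" shows "four_block P 0 0 S \<in> spd"
  using mexp_four_block[OF mlog_symmetric[OF assms(1)] mlog_symmetric[OF assms(2)]]
    mexp_spd[OF symmetric_four_block[OF mlog_symmetric[OF assms(1)] mlog_symmetric[OF assms(2)]]]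
  by (simp add: mexp_mlog assms)

lemma msqrt_four_block:
  assumes "P \<in> spd" "S \<in> spd" shows "msqrt (four_block P 0 0 S) = four_block (msqrt P) 0 0 (msqrt S)"
  using msqrt_unique[OF spd_four_block[OF msqrt_spd_square(1)[OF assms(1)] msqrt_spd_square(1)[OF assms(2)]]]
  by (simp add: four_block_mult msqrt_spd_square assms)

lemma det_four_block:
  assumes "P \<in> spd" "S \<in> spd" shows "det (four_block P 0 0 S) = det P * det S"
proof -
  obtain u l where u: "eigenbasis u l P" by (rule spd_eigenbasis[OF assms(1)]) blast
  obtain v m where v: "eigenbasis v m S" by (rule spd_eigenbasis[OF assms(2)]) blast
  show ?thesis
    by (simp add: det_eigenbasis[OF eigenbasis_four_block[OF u v]] det_eigenbasis[OF u] det_eigenbasis[OF v] prod_UNIV_sum)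
qed

lemma scaleR_matrix_mult:
  fixes A :: "real^'a::finite^'b::finite" and B :: "real^'c::finite^'a"
  shows "(c *\<^sub>R A) ** B = c *\<^sub>R (A ** B)" "A ** (c *\<^sub>R B) = c *\<^sub>R (A ** B)"
  by (simp_all add: vec_eq_iff matrix_matrix_mult_def sum_distrib_left mult_ac)

lemma spd_scaleR: "c > 0 \<Longrightarrow> S \<in> spd \<Longrightarrow> c *\<^sub>R S \<in> spd"
  by (simp add: spd_def scaleR_matrix_vector_assoc[symmetric])

lemma msqrt_scaleR:
  assumes "c > 0" "S \<in> spd" shows "msqrt (c *\<^sub>R S) = sqrt c *\<^sub>R msqrt S"
proof -
  have "(sqrt c *\<^sub>R msqrt S) ** (sqrt c *\<^sub>R msqrt S) = c *\<^sub>R S"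
    using assms by (simp add: scaleR_matrix_mult msqrt_spd_square)
  with msqrt_unique[OF spd_scaleR[OF _ msqrt_spd_square(1)[OF assms(2)]], of "sqrt c"] assms(1)
  show ?thesis by simp
qed

lemma det_scaleR_spd:
  fixes S :: "real^'a::finite^'a"
  assumes "S \<in> spd" shows "det (c *\<^sub>R S) = c ^ CARD('a) * det S"
proof -
  obtain u l where u: "eigenbasis u l S" by (rule spd_eigenbasis[OF assms]) blast
  show ?thesis
    by (simp add: det_eigenbasis[OF u] det_eigenbasis[OF eigenbasis_scaleR[OF u]] prod.distrib)
qed

lemma unipotent_block_inverse:
  "four_block (mat 1) 0 T (mat 1) ** four_block (mat 1) 0 (- T) (mat 1) = mat 1"
  "four_block (mat 1) 0 (- T) (mat 1) ** four_block (mat 1) 0 T (mat 1) = mat 1"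
  by (simp_all add: four_block_mult four_block_mat1)

text \<open>
Conjugation by $\mathrm{diag}(I,-I)$ inverts the matrix without changing its determinant. The sign
of the determinant is left open; only its square enters the determinant of a congruence.
\<close>

lemma det_unipotent_block:
  fixes T :: "real^'m::finite^'n::finite"
  shows "(det (four_block (mat 1) 0 T (mat 1)))\<^sup>2 = 1"
proof -
  define L L' J :: "real^('m + 'n)^('m + 'n)" where "L = four_block (mat 1) 0 T (mat 1)"
    and "L' = four_block (mat 1) 0 (- T) (mat 1)" and "J = four_block (mat 1) 0 0 (- mat 1)"
  have neg: "- X ** Y = - (X ** Y)" "X ** - Y = - (X ** Y)"
    for X :: "real^'z::finite^'y::finite" and Y :: "real^'x::finite^'z"
    by (simp_all add: vec_eq_iff matrix_matrix_mult_def sum_negf)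
  have "J ** J = mat 1" by (simp add: J_def four_block_mult four_block_mat1 neg)
  from arg_cong[OF this, of det] have J: "det J * det J = 1" by (simp add: det_mul)
  have "J ** L ** J = L'" by (simp add: J_def L_def L'_def four_block_mult neg)
  from arg_cong[OF this, of det] have "det L' = det L * (det J * det J)" by (simp add: det_mul mult_ac)
  then have "det L' = det L" using J by simp
  moreover have "L ** L' = mat 1" unfolding L_def L'_def by (rule unipotent_block_inverse)
  from arg_cong[OF this, of det] have "det L * det L' = 1" by (simp add: det_mul)
  ultimately show ?thesis by (simp add: L_def power2_eq_square)
qed

section \<open>Feasible controllers in the canonical frame\<close>

lemma matrix_inv_unique:
  fixes X Y :: "real^'a::finite^'a"
  assumes "X ** Y = mat 1" shows "matrix_inv X = Y"
proof -
  have YX: "Y ** X = mat 1" using assms matrix_left_right_inverse by blast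
  then have inv: "invertible X" using assms by (auto simp: invertible_def)
  have "matrix_inv X = matrix_inv X ** (X ** Y)" by (simp add: assms)
  also have "\<dots> = Y" by (simp add: matrix_mul_assoc matrix_inv_inverse[OF inv])
  finally show ?thesis .
qed

lemma transpose_matrix_inv:
  fixes X :: "real^'a::finite^'a"
  assumes "invertible X" shows "matrix_inv (transpose X) = transpose (matrix_inv X)"
  by (rule matrix_inv_unique)
     (simp add: matrix_transpose_mul[symmetric] matrix_inv_inverse[OF assms])

lemma hcat_join: "hcat U V *v join x y = U *v x + V *v y"
  by (simp add: vec_eq_iff hcat_def join_def matrix_vector_mult_def sum_UNIV_sum)

lemma transpose_hcat_mult: "transpose (hcat U V) *v z = join (transpose U *v z) (transpose V *v z)"
  by (simp add: vec_eq_iff_sum hcat_def join_def matrix_vector_mult_def transpose_def)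

locale canonical_frame =
  fixes A B U :: "real^'m::finite^('m + 'n::finite)"
    and V :: "real^'n^('m + 'n)"
    and C :: "real^'m^'m"
  assumes A: "A = U ** C" and C: "invertible C"
    and UV: "orthogonal_matrix (hcat U V)" and B: "B \<in> feasible_targets A"
begin

abbreviation "M \<equiv> M_of C A B"
abbreviation "T \<equiv> T_of V C A B"
abbreviation "L \<equiv> L_of V C A B"
abbreviation Q :: "real^'n^'n \<Rightarrow> real^('m + 'n)^('m + 'n)" where "Q \<equiv> Q_of C A B"
abbreviation "R0 \<equiv> R0_of V C A B"
abbreviation "F \<equiv> f_obj V C A B"
abbreviation "W \<equiv> W_of V C A B"
abbreviation "\<Phi> \<equiv> Phi U V C A B"
definition "\<rho> = det M powr (- 1 / real CARD('n))"
definition "Z = hcat U V ** L"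

lemma M_spd: "M \<in> spd"
proof -
  have "invertible (matrix_inv (transpose C))"
    using C matrix_inv_inverse[OF transpose_invertible[OF C]] unfolding invertible_def by blast
  then have "matrix_inv (transpose C) ** (transpose A ** B) ** transpose (matrix_inv (transpose C)) \<in> spd"
    using B by (intro spd_congruence_invertible) (simp_all add: feasible_targets_def)
  then show ?thesis
    by (simp add: M_of_def transpose_matrix_inv[OF C] matrix_mul_assoc)
qed

lemma rho_pos: "\<rho> > 0" using spd_det_pos[OF M_spd] by (simp add: \<rho>_def)

lemma rho_power: "\<rho> ^ CARD('n) = 1 / det M"
proof -
  have "\<rho> ^ CARD('n) = \<rho> powr real CARD('n)" by (rule powr_realpow[OF rho_pos, symmetric])
  also have "\<dots> = det M powr (- 1)" unfolding \<rho>_def powr_powr by simp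
  finally show ?thesis using spd_det_pos[OF M_spd] by (simp add: powr_minus_divide)
qed

lemma Q_eq: "Q S = four_block M 0 0 (\<rho> *\<^sub>R S)"
  by (simp add: Q_of_def \<rho>_def)

lemma spd1_spd: "S \<in> spd1 \<Longrightarrow> S \<in> spd" by (simp add: spd1_def)

lemma Q_spd: "S \<in> spd \<Longrightarrow> Q S \<in> spd"
  unfolding Q_eq by (intro spd_four_block M_spd spd_scaleR rho_pos)

lemma det_Q: "S \<in> spd1 \<Longrightarrow> det (Q S) = 1"
  using rho_power spd_det_pos[OF M_spd] unfolding Q_eq
  by (subst det_four_block) (auto simp: M_spd spd_scaleR rho_pos det_scaleR_spd spd1_def)

lemma L_inverse: "L ** four_block (mat 1) 0 (- T) (mat 1) = mat 1"
  unfolding L_of_def by (rule unipotent_block_inverse)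

lemma Z_invertible: "invertible Z"
proof -
  have "det (hcat U V) \<noteq> 0" using det_orthogonal_matrix[OF UV] by auto
  moreover have "det L \<noteq> 0" using det_unipotent_block[of T] by (auto simp: L_of_def)
  ultimately show ?thesis by (simp add: Z_def invertible_det_nz det_mul)
qed

lemma Phi_eq: "\<Phi> S = Z ** Q S ** transpose Z"
  by (simp add: Phi_def Z_def matrix_transpose_mul matrix_mul_assoc)

lemma R0_factor:
  defines "K \<equiv> four_block (mat 1) 0 (- T) (mat 1)"
  shows "R0 = K ** mat 1 ** transpose K"
proof -
  have "matrix_inv L = K" unfolding K_def by (rule matrix_inv_unique[OF L_inverse])
  moreover have "invertible L" using L_inverse matrix_left_right_inverse by (auto simp: invertible_def)
  ultimately show ?thesis by (simp add: R0_of_def transpose_matrix_inv)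
qed

lemma R0_spd: "R0 \<in> spd"
  unfolding R0_factor
  by (intro spd_congruence_invertible mat1_spd)
     (use unipotent_block_inverse[of T] in \<open>auto simp: invertible_def\<close>)

text \<open>
This identifies $R_0$ with the identity matrix in the frame of \<open>Z\<close>, so congruence by \<open>Z\<close> carries
distances from $R_0$ to distances from $I$.
\<close>

lemma Z_R0: "Z ** R0 ** transpose Z = mat 1"
proof -
  let ?K = "four_block (mat 1) 0 (- T) (mat 1)"
  have "Z ** R0 ** transpose Z = hcat U V ** (L ** ?K) ** transpose (L ** ?K) ** transpose (hcat U V)"
    by (simp add: R0_factor Z_def matrix_transpose_mul matrix_mul_assoc)
  also have "\<dots> = mat 1" using UV unfolding L_inverse by (simp add: orthogonal_matrix_def)
  finally show ?thesis .
qed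

lemma d_AI_Phi:
  assumes "S \<in> spd" "S' \<in> spd" shows "d_AI (\<Phi> S) (\<Phi> S') = d_AI (Q S) (Q S')"
  unfolding Phi_eq by (intro d_AI_congruence Q_spd assms Z_invertible)

lemma d_AI_identity_Phi:
  assumes "S \<in> spd" shows "d_AI (mat 1) (\<Phi> S) = d_AI R0 (Q S)"
  unfolding Phi_eq Z_R0[symmetric] by (intro d_AI_congruence Q_spd assms Z_invertible R0_spd)

lemma Phi_spd1:
  assumes "S \<in> spd1" shows "\<Phi> S \<in> spd1"
proof -
  have "\<Phi> S \<in> spd"
    unfolding Phi_eq using assms by (intro spd_congruence_invertible Q_spd Z_invertible spd1_spd)
  moreover have "det (\<Phi> S) = (det (hcat U V))\<^sup>2 * (det L)\<^sup>2"
    by (simp add: Phi_eq Z_def det_mul det_Q[OF assms] power2_eq_square)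
  then have "det (\<Phi> S) = 1"
    using det_orthogonal_matrix[OF UV] det_unipotent_block[of T] by (auto simp: L_of_def)
  ultimately show ?thesis by (simp add: spd1_def)
qed

lemma T_M: "T ** M = N_of V C B"
  by (simp add: T_of_def matrix_mul_assoc[symmetric] spd_matrix_inv[OF M_spd])

text \<open>
In the orthonormal frame, $A$ has only an upper block. The transposed factor $L^\top$ fixes it,
the block $M$ acts on it, and $L$ then restores $N = TM$ below.
\<close>

lemma Phi_A: "\<Phi> S ** A = B"
proof -
  have "\<Phi> S *v (A *v x) = B *v x" for x
  proof -
    define y where "y = C *v x"
    have Ax: "A *v x = hcat U V *v join y 0" by (simp add: A y_def hcat_join matrix_vector_mul_assoc)
    have "transpose (hcat U V) *v (A *v x) = join y 0"
      using UV by (simp add: Ax matrix_vector_mul_assoc orthogonal_matrix_def)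
    moreover have "transpose L *v join y 0 = join y 0"
      by (simp add: L_of_def transpose_four_block four_block_join)
    moreover have "Q S *v join y 0 = join (M *v y) 0" by (simp add: Q_eq four_block_join)
    moreover have "L *v join (M *v y) 0 = join (M *v y) (N_of V C B *v y)"
      by (simp add: L_of_def four_block_join matrix_vector_mul_assoc T_M)
    ultimately have "\<Phi> S *v (A *v x) = U *v (M *v y) + V *v (N_of V C B *v y)"
      by (simp add: Phi_def matrix_vector_mul_assoc[symmetric] hcat_join)
    also have "M *v y = transpose U *v (B *v x)"
    proof -
      have "matrix_inv (transpose C) ** transpose C = mat 1"
        by (simp add: matrix_inv_inverse transpose_invertible C)
      then have "matrix_inv (transpose C) ** transpose A = transpose U"
        by (simp add: A matrix_transpose_mul matrix_mul_assoc)
      then show ?thesis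
        by (simp add: M_of_def y_def matrix_vector_mul_assoc matrix_mul_assoc[symmetric] matrix_inv_inverse C)
    qed
    also have "N_of V C B *v y = transpose V *v (B *v x)"
      by (simp add: N_of_def y_def matrix_vector_mul_assoc matrix_mul_assoc[symmetric] matrix_inv_inverse C)
    also have "U *v (transpose U *v (B *v x)) + V *v (transpose V *v (B *v x))
        = hcat U V *v (transpose (hcat U V) *v (B *v x))"
      by (simp only: hcat_join transpose_hcat_mult)
    also have "\<dots> = B *v x"
      using UV by (simp add: matrix_vector_mul_assoc matrix_mul_assoc orthogonal_matrix_def)
    finally show ?thesis .
  qed
  then show ?thesis by (simp add: matrix_eq matrix_vector_mul_assoc)
qed

text \<open>
Every $\Phi_A(B,\Sigma)$ is feasible, so it is no closer to $I$ than the canonical controller.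
\<close>

lemma F_minimal:
  assumes "\<Phi> Sstar = controller A B" "Sstar \<in> spd1" "S \<in> spd1"
  shows "F Sstar \<le> F S"
proof -
  have "\<not> d_AI (mat 1) (\<Phi> S) < d_AI (mat 1) (\<Phi> Sstar)"
    using controller_minimizes[OF Phi_spd1[OF assms(3)] Phi_A] Phi_spd1[OF assms(3)] Phi_A[of S]
    unfolding assms(1) is_arg_min_def by blast
  then have "d_AI R0 (Q Sstar) \<le> d_AI R0 (Q S)" using assms(2,3)
    by (simp add: assms(1)[symmetric] d_AI_identity_Phi spd1_spd)
  then show ?thesis by (simp add: f_obj_def d_AI_def power_mono)
qed

section \<open>Inexact gradient descent\<close>

text \<open>
The tangent directions of $\mathscr P_n$ at $\Sigma$, after congruence by $\Sigma^{-1/2}$.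
\<close>

definition trace_free_symmetric :: "real^'n^'n \<Rightarrow> bool" where
  "trace_free_symmetric X \<longleftrightarrow> transpose X = X \<and> trace X = 0"

lemma trace_free_symmetric_scaleR: "trace_free_symmetric X \<Longrightarrow> trace_free_symmetric (c *\<^sub>R X)"
  by (simp add: trace_free_symmetric_def trace_def flip: sum_distrib_left)

lemma move_spd1:
  assumes "S \<in> spd1" "trace_free_symmetric X" shows "msqrt S ** mexp X ** msqrt S \<in> spd1"
proof -
  have "det (msqrt S) * det (msqrt S) = det S"
    using msqrt_spd_square[OF spd1_spd[OF assms(1)]] det_mul by metis
  then show ?thesis
    using assms geodesic_spd[of S X] by (simp add: spd1_def trace_free_symmetric_def det_mul det_mexp mult_ac)
qed

lemma move_between:
  assumes "S \<in> spd1" "S' \<in> spd1"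
  obtains X where "trace_free_symmetric X" "msqrt S ** mexp X ** msqrt S = S'"
proof -
  define X where "X = mlog (matrix_inv (msqrt S) ** S' ** matrix_inv (msqrt S))"
  note X = geodesic_to[OF assms[THEN spd1_spd], folded X_def]
  have "det (msqrt S) * det (msqrt S) = det S"
    using msqrt_spd_square[OF spd1_spd[OF assms(1)]] det_mul by metis
  moreover have "det (msqrt S) * det (mexp X) * det (msqrt S) = det S'" by (metis X(2) det_mul)
  ultimately have "det (mexp X) = 1" using assms by (simp add: spd1_def mult_ac)
  then have "trace X = 0" by (simp add: det_mexp[OF X(1)])
  then show ?thesis using that X by (simp add: trace_free_symmetric_def)
qed

lemma embed_symmetric: "trace_free_symmetric X \<Longrightarrow> transpose (four_block 0 0 0 X) = four_block 0 0 0 X"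
  by (rule symmetric_four_block) (simp_all add: trace_free_symmetric_def transpose_def vec_eq_iff)

text \<open>
The embedding $\Sigma \mapsto \mathcal Q_\Sigma$ carries geodesics to geodesics: the block $M$ and
the scalar $\rho$ pass through the square roots unchanged.
\<close>

lemma Q_move:
  assumes "S \<in> spd1" "trace_free_symmetric X"
  shows "msqrt (Q S) ** mexp (four_block 0 0 0 X) ** msqrt (Q S) = Q (msqrt S ** mexp X ** msqrt S)"
proof -
  have z: "transpose (0::real^'m^'m) = 0" by (simp add: transpose_def vec_eq_iff)
  have X: "transpose X = X" using assms by (simp add: trace_free_symmetric_def)
  show ?thesis
    using rho_pos unfolding Q_eq
    by (simp add: msqrt_four_block M_spd spd_scaleR spd1_spd assms msqrt_scaleR mexp_four_block[OF z X] four_block_mult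
       msqrt_spd_square scaleR_matrix_mult)
qed

text \<open>
The trace correction in $W_B$ is orthogonal to trace-free directions, so $-W_B$ represents the
derivative of $f_B$.
\<close>

lemma W_inner: "trace_free_symmetric X \<Longrightarrow> W S \<bullet> X = R_log V C A B S \<bullet> four_block 0 0 0 X"
  using matrix_inner_trace[of "mat 1" X]
  by (simp add: W_of_def inner_diff_left inner_four_block_lower_right trace_free_symmetric_def transpose_mat)

lemma F_strongly_convex:
  assumes S: "S \<in> spd1" and X: "trace_free_symmetric X"
  shows "F S - W S \<bullet> X + (norm X)\<^sup>2 / 2 \<le> F (msqrt S ** mexp X ** msqrt S)"
proof -
  interpret spd_geodesic R0 "Q S" "four_block 0 0 0 X"
    by unfold_locales (use S X in \<open>auto intro: R0_spd Q_spd spd1_spd embed_symmetric\<close>)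
  show ?thesis
    using squared_distance_strongly_convex
    by (simp add: f_obj_def point_def Q_move[OF S X] W_inner[OF X] R_log_def residual_def norm_four_block_lower_right)
qed

lemma F_descent:
  assumes S: "S \<in> spd1" and X: "trace_free_symmetric X" and "0 < \<eta>" "d_AI R0 (Q S) \<le> D"
    and "\<eta> / 2 * (psi (D / sqrt 2) * (norm X)\<^sup>2) < W S \<bullet> X"
  shows "F (msqrt S ** mexp (\<eta> *\<^sub>R X) ** msqrt S)
    \<le> F S - \<eta> * (W S \<bullet> X) + \<eta>\<^sup>2 / 2 * (psi (D / sqrt 2) * (norm X)\<^sup>2)"
proof -
  interpret spd_geodesic R0 "Q S" "four_block 0 0 0 X"
    by unfold_locales (use S X in \<open>auto intro: R0_spd Q_spd spd1_spd embed_symmetric\<close>)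
  have "\<eta> *\<^sub>R four_block 0 0 0 X = (four_block 0 0 0 (\<eta> *\<^sub>R X) :: real^('m + 'n)^('m + 'n))"
    by (simp add: scaleR_four_block)
  then have "point \<eta> = Q (msqrt S ** mexp (\<eta> *\<^sub>R X) ** msqrt S)"
    by (simp add: point_def Q_move[OF S trace_free_symmetric_scaleR[OF X]])
  then show ?thesis
    using squared_distance_descent[of \<eta> D] assms
    by (simp add: f_obj_def W_inner[OF X] R_log_def residual_def norm_four_block_lower_right)
qed

lemma d_AI_Phi_move:
  assumes S: "S \<in> spd1" and X: "trace_free_symmetric X"
  shows "d_AI (\<Phi> S) (\<Phi> (msqrt S ** mexp X ** msqrt S)) = norm X"
  using d_AI_geodesic[OF Q_spd[OF spd1_spd[OF S]] embed_symmetric[OF X]] S move_spd1[OF S X]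
  by (simp add: d_AI_Phi spd1_spd Q_move[OF S X] norm_four_block_lower_right)

text \<open>
A positive inner product would make a short step along $X$ decrease the objective. The step
$\langle W, X\rangle / K$ minimizes the quadratic upper bound.
\<close>

lemma W_at_minimum:
  assumes S: "S \<in> spd1" and min: "\<And>S'. S' \<in> spd1 \<Longrightarrow> F S \<le> F S'" and X: "trace_free_symmetric X"
  shows "W S \<bullet> X \<le> 0"
proof (rule ccontr)
  assume "\<not> W S \<bullet> X \<le> 0"
  then have pos: "W S \<bullet> X > 0" by simp
  define K where "K = psi (d_AI R0 (Q S) / sqrt 2) * (norm X)\<^sup>2"
  have "X \<noteq> 0" using pos by auto
  then have K: "K > 0" unfolding K_def
    by (intro mult_pos_pos less_le_trans[OF zero_less_one psi_ge_1]) simp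
  define \<eta> where "\<eta> = (W S \<bullet> X) / K"
  have \<eta>: "\<eta> > 0" "\<eta> * K = W S \<bullet> X" using pos K by (auto simp: \<eta>_def)
  have "F (msqrt S ** mexp (\<eta> *\<^sub>R X) ** msqrt S) \<le> F S - \<eta> * (W S \<bullet> X) + \<eta>\<^sup>2 / 2 * K"
    unfolding K_def by (rule F_descent[OF S X \<eta>(1) order_refl]) (use pos \<eta> in \<open>simp add: K_def\<close>)
  moreover have "\<eta>\<^sup>2 / 2 * K = \<eta> * (W S \<bullet> X) / 2" using \<eta>(2) by (simp add: power2_eq_square)
  moreover have "\<eta> * (W S \<bullet> X) > 0" using pos \<eta> by simp
  ultimately have "F (msqrt S ** mexp (\<eta> *\<^sub>R X) ** msqrt S) < F S" by linarith
  then show False using min[OF move_spd1[OF S trace_free_symmetric_scaleR[OF X]]] by (simp add: not_le[symmetric])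
qed

text \<open>
Strong convexity from $\Sigma$ towards $\Sigma_\star$ bounds the gap by $\|W\|^2/2$; from $\Sigma_\star$
towards $\Sigma$, where the first-order term is nonnegative, it bounds the gap from below. Together they
give $\|X\|^2 \le \langle W, X\rangle$ for the velocity $X$ joining the two points, hence the sharp
bound on the distance.
\<close>

lemma gap_bounds:
  assumes S: "S \<in> spd1" and star: "Sstar \<in> spd1" "\<Phi> Sstar = controller A B"
  shows "F S - F Sstar \<le> (norm (W S))\<^sup>2 / 2"
    and "(d_AI (\<Phi> S) (controller A B))\<^sup>2 / 2 \<le> F S - F Sstar"
    and "d_AI (\<Phi> S) (controller A B) \<le> norm (W S)"
proof -
  obtain X where X: "trace_free_symmetric X" "msqrt S ** mexp X ** msqrt S = Sstar" using move_between[OF S star(1)] .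
  obtain Y where Y: "trace_free_symmetric Y" "msqrt Sstar ** mexp Y ** msqrt Sstar = S" using move_between[OF star(1) S] .
  have dX: "d_AI (\<Phi> S) (controller A B) = norm X" using d_AI_Phi_move[OF S X(1)] X star by simp
  have dY: "d_AI (\<Phi> S) (controller A B) = norm Y"
    using d_AI_Phi_move[OF star(1) Y(1)] Y star d_AI_commute[of "\<Phi> S" "\<Phi> Sstar"] Phi_spd1[OF S] Phi_spd1[OF star(1)]
    by (simp add: spd1_def)
  have 1: "F S - W S \<bullet> X + (norm X)\<^sup>2 / 2 \<le> F Sstar" using F_strongly_convex[OF S X(1)] X by simp
  have "W Sstar \<bullet> Y \<le> 0" by (rule W_at_minimum[OF star(1) F_minimal[OF star(2,1)] Y(1)])
  then have 2: "F Sstar + (norm X)\<^sup>2 / 2 \<le> F S"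
    using F_strongly_convex[OF star(1) Y(1)] Y dX dY by simp
  show "(d_AI (\<Phi> S) (controller A B))\<^sup>2 / 2 \<le> F S - F Sstar" using 2 dX by simp
  have cs: "W S \<bullet> X \<le> norm (W S) * norm X" by (rule norm_cauchy_schwarz)
  have "0 \<le> (norm (W S) - norm X)\<^sup>2" by simp
  then show "F S - F Sstar \<le> (norm (W S))\<^sup>2 / 2" using 1 cs by (simp add: power2_diff)
  have "norm X * norm X \<le> norm (W S) * norm X" using 1 2 cs by (simp add: power2_eq_square)
  then show "d_AI (\<Phi> S) (controller A B) \<le> norm (W S)" unfolding dX
    by (cases "norm X = 0") (auto dest: mult_right_le_imp_le)
qed

end

text \<open>
Measured against the observed vector, the error is at most $\delta/(1+\delta)$; against the exact
vector this becomes $\delta$. Both forms are needed, the first for the step-size condition and the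
second for the rate.
\<close>

lemma relative_error_bounds:
  fixes W E Wt :: "'a::real_inner"
  assumes Wt: "Wt = W + E" and E: "norm E \<le> \<delta> / (1 + \<delta>) * norm Wt" and \<delta>: "0 \<le> \<delta>" "\<delta> < 1"
  shows "norm Wt \<le> (1 + \<delta>) * norm W" "norm W \<le> norm Wt / (1 - \<delta>)"
    "(1 - \<delta>) * (norm W)\<^sup>2 \<le> W \<bullet> Wt" "(norm Wt)\<^sup>2 / (1 + \<delta>) \<le> W \<bullet> Wt"
proof -
  have E': "(1 + \<delta>) * norm E \<le> \<delta> * norm Wt" using E \<delta> by (simp add: field_simps)
  have t1: "norm Wt \<le> norm W + norm E" unfolding Wt by (rule norm_triangle_ineq)
  have t2: "norm W \<le> norm Wt + norm E" unfolding Wt using norm_triangle_ineq4[of "W + E" E] by simp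
  have "(1 + \<delta>) * norm Wt \<le> (1 + \<delta>) * (norm W + norm E)" using t1 \<delta> by (intro mult_left_mono) auto
  with E' show 1: "norm Wt \<le> (1 + \<delta>) * norm W" by (simp add: algebra_simps)
  have "(1 + \<delta>) * norm E \<le> (1 + \<delta>) * (\<delta> * norm W)"
    using E' mult_left_mono[OF 1 \<delta>(1)] by (simp add: mult_ac)
  then have EW: "norm E \<le> \<delta> * norm W" using \<delta> by simp
  have "(1 - \<delta>) * norm W \<le> norm Wt"
    using EW norm_triangle_ineq4[of "W + E" E] unfolding Wt by (simp add: algebra_simps)
  then show "norm W \<le> norm Wt / (1 - \<delta>)" using \<delta> by (simp add: field_simps)
  have "- (W \<bullet> E) \<le> norm W * norm E" using norm_cauchy_schwarz[of W "- E"] by simp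
  also have "\<dots> \<le> norm W * (\<delta> * norm W)" using EW by (intro mult_left_mono) auto
  finally show "(1 - \<delta>) * (norm W)\<^sup>2 \<le> W \<bullet> Wt"
    by (simp add: Wt inner_add_right power2_norm_eq_inner[symmetric] power2_eq_square algebra_simps)
  have "E \<bullet> Wt \<le> norm E * norm Wt" by (rule norm_cauchy_schwarz)
  also have "\<dots> \<le> \<delta> / (1 + \<delta>) * norm Wt * norm Wt" using E by (intro mult_right_mono) auto
  finally have "Wt \<bullet> Wt - \<delta> / (1 + \<delta>) * norm Wt * norm Wt \<le> W \<bullet> Wt"
    by (simp add: Wt inner_add_left)
  moreover have "(norm Wt)\<^sup>2 / (1 + \<delta>) = Wt \<bullet> Wt - \<delta> / (1 + \<delta>) * norm Wt * norm Wt"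
    using \<delta> by (simp add: power2_norm_eq_inner[symmetric] power2_eq_square field_simps)
  ultimately show "(norm Wt)\<^sup>2 / (1 + \<delta>) \<le> W \<bullet> Wt" by simp
qed

context canonical_frame begin

text \<open>
With $\eta K (1+\delta)^2 = 1 - \delta$, the quadratic term is exactly half of the guaranteed
first-order decrease $\eta(1-\delta)\|W\|^2$.
\<close>

lemma inexact_step:
  fixes \<delta> D \<eta> :: real
  defines "K \<equiv> psi (D / sqrt 2)"
  assumes S: "S \<in> spd1" and D: "d_AI R0 (Q S) \<le> D" and Wt: "trace_free_symmetric Wt" "Wt = W S + E"
    and E: "norm E \<le> \<delta> / (1 + \<delta>) * norm Wt" and \<delta>: "0 \<le> \<delta>" "\<delta> < 1"
    and \<eta>: "\<eta> = (1 - \<delta>) / (K * (1 + \<delta>)\<^sup>2)"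
  shows "F (msqrt S ** mexp (\<eta> *\<^sub>R Wt) ** msqrt S) \<le> F S - ((1 - \<delta>) / (1 + \<delta>))\<^sup>2 / K * ((norm (W S))\<^sup>2 / 2)"
proof -
  note b = relative_error_bounds[OF Wt(2) E \<delta>]
  have K: "K \<ge> 1" unfolding K_def by (rule psi_ge_1)
  have \<eta>0: "\<eta> > 0" using K \<delta> by (simp add: \<eta>)
  have \<eta>K: "\<eta> * K * (1 + \<delta>)\<^sup>2 = 1 - \<delta>" using K \<delta> by (simp add: \<eta>)
  have \<eta>c: "\<eta> * (1 - \<delta>) = ((1 - \<delta>) / (1 + \<delta>))\<^sup>2 / K"
    by (simp add: \<eta> power_divide power2_eq_square)
  show ?thesis
  proof (cases "Wt = 0")
    case True
    then have "W S = 0" using b(2) by simp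
    then show ?thesis using True msqrt_spd_square[OF spd1_spd[OF S]] by simp
  next
    case False
    \<comment> \<open>The step is shorter than the descent bound requires, by a factor of at least two.\<close>
    have "\<eta> * K = (1 - \<delta>) / (1 + \<delta>) / (1 + \<delta>)" using K by (simp add: \<eta> power2_eq_square)
    also have "\<dots> \<le> 1 / (1 + \<delta>)" using \<delta> by (intro divide_right_mono) (auto simp: divide_le_eq)
    finally have "\<eta> * K / 2 < 1 / (1 + \<delta>)" using \<eta>0 K \<delta>
      by (smt (verit) field_sum_of_halves zero_less_divide_iff)
    then have "\<eta> / 2 * (K * (norm Wt)\<^sup>2) < (norm Wt)\<^sup>2 / (1 + \<delta>)"
      using mult_strict_right_mono[of "\<eta> * K / 2" "1 / (1 + \<delta>)" "(norm Wt)\<^sup>2"] False by (simp add: mult_ac)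
    also note b(4)
    finally have "F (msqrt S ** mexp (\<eta> *\<^sub>R Wt) ** msqrt S) \<le> F S - \<eta> * (W S \<bullet> Wt) + \<eta>\<^sup>2 / 2 * (K * (norm Wt)\<^sup>2)"
      unfolding K_def by (intro F_descent[OF S Wt(1) \<eta>0 D])
    also have "\<dots> \<le> F S - \<eta> * ((1 - \<delta>) * (norm (W S))\<^sup>2) + \<eta>\<^sup>2 / 2 * (K * ((1 + \<delta>) * norm (W S))\<^sup>2)"
      using b(1,3) \<eta>0 K by (intro add_mono diff_mono mult_left_mono power_mono) auto
    also have "\<eta>\<^sup>2 / 2 * (K * ((1 + \<delta>) * norm (W S))\<^sup>2) = \<eta> / 2 * (\<eta> * K * (1 + \<delta>)\<^sup>2) * (norm (W S))\<^sup>2"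
      by (simp add: power_mult_distrib power2_eq_square)
    also have "F S - \<eta> * ((1 - \<delta>) * (norm (W S))\<^sup>2) + \<eta> / 2 * (\<eta> * K * (1 + \<delta>)\<^sup>2) * (norm (W S))\<^sup>2
      = F S - \<eta> * (1 - \<delta>) * ((norm (W S))\<^sup>2 / 2)"
      unfolding \<eta>K by (simp add: field_simps)
    finally show ?thesis unfolding \<eta>c .
  qed
qed

end

theorem corollary3:
  fixes A B U :: "real^'m::finite^('m + 'n::finite)"
    and V :: "real^'n^('m + 'n)"
    and C :: "real^'m^'m"
    and Sstar :: "real^'n^'n"
    and S E Wt :: "nat \<Rightarrow> real^'n^'n"
    and b :: "nat \<Rightarrow> real"
    and D0 D0hat \<delta> L0hat c\<delta> q\<delta> \<eta> :: real
  assumes "rank A = CARD('m)"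
    and "A = U ** C" and "transpose U ** U = mat 1" and "invertible C"
    and "orthogonal_matrix (hcat U V)"
    and "B \<in> feasible_targets A"
    and "Sstar \<in> spd1" and "Phi U V C A B Sstar = controller A B"
    and "S 0 \<in> spd1"
    and "D0 = d_AI (R0_of V C A B) (Q_of C A B (S 0))"
    and "D0hat \<ge> D0"
    and "0 \<le> \<delta>" and "\<delta> < 1"
    and "L0hat = psi (D0hat / sqrt 2)"
    and "c\<delta> = ((1 - \<delta>) / (1 + \<delta>))\<^sup>2"
    and "q\<delta> = 1 - c\<delta> / L0hat"
    and "\<eta> = (1 - \<delta>) / (L0hat * (1 + \<delta>)\<^sup>2)"
    and "\<And>k. transpose (Wt k) = Wt k" and "\<And>k. trace (Wt k) = 0"
    and "\<And>k. Wt k = W_of V C A B (S k) + E k"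
    and "\<And>k. b k \<ge> norm (E k)"
    and "\<And>k. b k \<le> \<delta> / (1 + \<delta>) * norm (Wt k)"
    and "\<And>k. S (Suc k) = msqrt (S k) ** mexp (\<eta> *\<^sub>R Wt k) ** msqrt (S k)"
  shows "decseq (\<lambda>k. d_AI (R0_of V C A B) (Q_of C A B (S k)))
    \<and> (\<forall>k.
        f_obj V C A B (S k) - f_obj V C A B Sstar \<le> D0hat\<^sup>2 / 2 * q\<delta> ^ k
      \<and> d_AI (Phi U V C A B (S k)) (controller A B) \<le> D0hat * sqrt q\<delta> ^ k
      \<and> norm (Wt k) \<le> (1 + \<delta>)\<^sup>2 / (1 - \<delta>) * sqrt L0hat * D0hat * sqrt q\<delta> ^ k
      \<and> d_AI (Phi U V C A B (S k)) (controller A B) \<le> norm (Wt k) / (1 - \<delta>)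
      \<and> f_obj V C A B (S k) - f_obj V C A B Sstar \<le> (norm (Wt k))\<^sup>2 / (2 * (1 - \<delta>)\<^sup>2))"
proof -
  interpret canonical_frame A B U V C
    by unfold_locales (fact assms)+
  note \<delta> = \<open>0 \<le> \<delta>\<close> \<open>\<delta> < 1\<close>
  note star = \<open>Sstar \<in> spd1\<close> \<open>\<Phi> Sstar = controller A B\<close>
  have dir: "trace_free_symmetric (Wt k)" for k using assms(18,19) by (simp add: trace_free_symmetric_def)
  have err: "norm (E k) \<le> \<delta> / (1 + \<delta>) * norm (Wt k)" for k using assms(21,22) order_trans by blast
  note bounds = relative_error_bounds[OF assms(20) err \<delta>]
  have nn: "0 \<le> d_AI X Y" for X Y :: "real^('m + 'n)^('m + 'n)" by (simp add: d_AI_def)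
  have D0hat: "0 \<le> D0hat" using assms(10,11) nn order_trans by blast
  have L1: "1 \<le> L0hat" unfolding assms(14) by (rule psi_ge_1)
  have c: "0 < c\<delta>" "c\<delta> \<le> 1" using \<delta> by (auto simp: assms(15) divide_le_eq intro!: power_le_one)
  have q: "0 \<le> q\<delta>" using c L1 by (simp add: assms(16) divide_le_eq)
  have F_mono: "F X \<le> F Y \<longleftrightarrow> d_AI R0 (Q X) \<le> d_AI R0 (Q Y)" for X Y
    using abs_le_square_iff[of "d_AI R0 (Q X)" "d_AI R0 (Q Y)"] nn by (simp add: f_obj_def)
  have step: "S (Suc k) \<in> spd1 \<and> F (S (Suc k)) \<le> F (S k) - c\<delta> / L0hat * ((norm (W (S k)))\<^sup>2 / 2)"
    if "S k \<in> spd1" "d_AI R0 (Q (S k)) \<le> D0hat" for k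
    using inexact_step[OF that dir assms(20) err \<delta>] move_spd1[OF that(1) trace_free_symmetric_scaleR[OF dir]]
      assms(14,15,17,23) by simp
  have inv: "S k \<in> spd1 \<and> d_AI R0 (Q (S k)) \<le> D0hat" for k
  proof (induction k)
    case (Suc k)
    then have *: "S (Suc k) \<in> spd1" "F (S (Suc k)) \<le> F (S k) - c\<delta> / L0hat * ((norm (W (S k)))\<^sup>2 / 2)"
      using step by auto
    moreover have "0 \<le> c\<delta> / L0hat * ((norm (W (S k)))\<^sup>2 / 2)" using c L1 by simp
    ultimately have "F (S (Suc k)) \<le> F (S k)" by linarith
    then show ?case using * Suc F_mono by force
  qed (use assms in auto)
  then have Sk: "S k \<in> spd1" for k by blast
  have descent: "F (S (Suc k)) \<le> F (S k) - c\<delta> / L0hat * ((norm (W (S k)))\<^sup>2 / 2)" for k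
    using step inv by blast
  note gap = gap_bounds[OF Sk star]
  have dec: "decseq (\<lambda>k. d_AI R0 (Q (S k)))"
  proof (rule decseq_SucI)
    fix k
    have "0 \<le> c\<delta> / L0hat * ((norm (W (S k)))\<^sup>2 / 2)" using c L1 by simp
    then show "d_AI R0 (Q (S (Suc k))) \<le> d_AI R0 (Q (S k))" using descent[of k] F_mono by force
  qed
  have lin: "F (S k) - F Sstar \<le> D0hat\<^sup>2 / 2 * q\<delta> ^ k" for k
  proof (induction k)
    case 0
    have "F (S 0) \<le> D0hat\<^sup>2 / 2" using inv[of 0] nn by (simp add: f_obj_def power_mono)
    moreover have "0 \<le> F Sstar" by (simp add: f_obj_def)
    ultimately show ?case by simp
  next
    case (Suc k)
    have "c\<delta> / L0hat * (F (S k) - F Sstar) \<le> c\<delta> / L0hat * ((norm (W (S k)))\<^sup>2 / 2)"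
      using gap(1) c L1 by (intro mult_left_mono) auto
    then have "F (S (Suc k)) - F Sstar \<le> q\<delta> * (F (S k) - F Sstar)"
      using descent[of k] by (simp add: assms(16) algebra_simps)
    also have "\<dots> \<le> q\<delta> * (D0hat\<^sup>2 / 2 * q\<delta> ^ k)" using Suc q by (intro mult_left_mono)
    finally show ?case by (simp add: mult_ac)
  qed
  have sq: "(D0hat * sqrt q\<delta> ^ k)\<^sup>2 = D0hat\<^sup>2 * q\<delta> ^ k" for k
  proof -
    have "(sqrt q\<delta> ^ k)\<^sup>2 = ((sqrt q\<delta>)\<^sup>2) ^ k" by (metis mult.commute power_mult)
    then show ?thesis using q by (simp add: power_mult_distrib)
  qed
  have nns: "0 \<le> D0hat * sqrt q\<delta> ^ k" for k using D0hat q by simp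
  have dist: "d_AI (\<Phi> (S k)) (controller A B) \<le> D0hat * sqrt q\<delta> ^ k" for k
  proof (rule power2_le_imp_le[OF _ nns])
    show "(d_AI (\<Phi> (S k)) (controller A B))\<^sup>2 \<le> (D0hat * sqrt q\<delta> ^ k)\<^sup>2"
      using gap(2)[of k] lin[of k] unfolding sq by linarith
  qed
  have W: "norm (W (S k)) \<le> (1 + \<delta>) / (1 - \<delta>) * sqrt L0hat * (D0hat * sqrt q\<delta> ^ k)" for k
  proof (rule power2_le_imp_le)
    \<comment> \<open>One step cannot decrease the objective by more than the current gap, which bounds the gradient.\<close>
    have "0 \<le> F (S (Suc k)) - F Sstar" using F_minimal[OF star(2,1) Sk] by simp
    then have "c\<delta> / L0hat * ((norm (W (S k)))\<^sup>2 / 2) \<le> D0hat\<^sup>2 / 2 * q\<delta> ^ k"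
      using descent[of k] lin[of k] by linarith
    then have "(norm (W (S k)))\<^sup>2 \<le> 1 / c\<delta> * L0hat * (D0hat\<^sup>2 * q\<delta> ^ k)"
      using c L1 by (simp add: field_simps)
    also have "1 / c\<delta> = ((1 + \<delta>) / (1 - \<delta>))\<^sup>2" by (simp add: assms(15) power_divide)
    finally show "(norm (W (S k)))\<^sup>2 \<le> ((1 + \<delta>) / (1 - \<delta>) * sqrt L0hat * (D0hat * sqrt q\<delta> ^ k))\<^sup>2"
      unfolding power_mult_distrib[of _ "D0hat * sqrt q\<delta> ^ k"] power_mult_distrib[of _ "sqrt L0hat"] sq
      using L1 by simp
  qed (use \<delta> L1 nns in simp)
  have Wt: "norm (Wt k) \<le> (1 + \<delta>)\<^sup>2 / (1 - \<delta>) * sqrt L0hat * D0hat * sqrt q\<delta> ^ k" for k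
  proof -
    have "norm (Wt k) \<le> (1 + \<delta>) * norm (W (S k))" by (rule bounds)
    also have "\<dots> \<le> (1 + \<delta>) * ((1 + \<delta>) / (1 - \<delta>) * sqrt L0hat * (D0hat * sqrt q\<delta> ^ k))"
      using W \<delta> by (intro mult_left_mono) auto
    finally show ?thesis by (simp add: power2_eq_square mult_ac)
  qed
  have cert: "d_AI (\<Phi> (S k)) (controller A B) \<le> norm (Wt k) / (1 - \<delta>)" for k
    using gap(3) bounds(2) order_trans by blast
  have "F (S k) - F Sstar \<le> (norm (Wt k))\<^sup>2 / (2 * (1 - \<delta>)\<^sup>2)" for k
  proof -
    have "(norm (W (S k)))\<^sup>2 \<le> (norm (Wt k) / (1 - \<delta>))\<^sup>2" using bounds(2) by (intro power_mono) auto
    then show ?thesis using gap(1)[of k] by (simp add: power_divide)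
  qed
  then show ?thesis using dec lin dist Wt cert by blast
qed

end
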